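(* For every $\lambda\in\Sigma^+$ there is $\lambda_I\in\Sigma^+\cup\{0\}$ such that for any vector $\xi\in\mathfrak m_\lambda$ the vector $I\xi$ belongs to $\mathfrak m_{\lambda_I}$; i.e. $\operatorname{ad}_w^2(\xi)=\lambda^2(w)\xi$ for all $w\in\mathfrak a$ implies $\operatorname{ad}_w^2(I\xi)=\lambda_I^2(w)(I\xi)$ for all $w\in\mathfrak a$. The set $\Sigma^+$ is a subset of $$(BC)_r^+=\left\{\tfrac i2\epsilon_j,\ i\epsilon_j,\ 1\le j\le r;\quad \tfrac i2(\epsilon_p\pm\epsilon_k),\ 1\le p<k\le r\right\},$$ and the set $\{(\lambda,\lambda_I):\lambda\in\Sigma^+\}$ is a subset of $$\left\{\bigl(\tfrac i2\epsilon_j,\tfrac i2\epsilon_j\bigr),\ \bigl(i\epsilon_j,0\bigr),\ 1\le j\le r;\quad \bigl(\tfrac i2(\epsilon_p\pm\epsilon_k),\tfrac i2(\epsilon_p\mp\epsilon_k)\bigr),\ 1\le p<k\le r\right\}.$$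
   Context: $G/K$ is an irreducible Hermitian symmetric space of compact type: $\mathfrak g=\mathrm{Lie}(G)$ is a simple compact Lie algebra, $K$ is connected, $\mathfrak g=\mathfrak k\oplus\mathfrak m$ with $[\mathfrak k,\mathfrak m]\subset\mathfrak m$, $[\mathfrak m,\mathfrak m]\subset\mathfrak k$; $\langle\,,\rangle$ is an $\operatorname{Ad}(G)$-invariant positive definite form on $\mathfrak g$ with $\mathfrak k\perp\mathfrak m$. The one-dimensional center of $\mathfrak k$ contains $Z_0$ such that $I=\operatorname{ad}_{Z_0}|_{\mathfrak m}$ satisfies $I^2=-\mathrm{Id}_{\mathfrak m}$ (the complex structure); $[I\xi,I\eta]=[\xi,\eta]$ and $I[\zeta,\eta]=[\zeta,I\eta]$ for $\xi,\eta\in\mathfrak m$, $\zeta\in\mathfrak k$. $\mathfrak a\subset\mathfrak m$ is a Cartan subspace (maximal abelian subspace of $\mathfrak m$), $r=\dim\mathfrak a$. It has a basis $X_1,\dots,X_r$ such that, with $Y_j=IX_j$ and $T_j=[X_j,Y_j]$, one has $[X_j,Y_k]=\delta_j^kT_j$, $[T_j,X_k]=\delta_j^kY_j$, $[T_j,Y_k]=-\delta_j^kX_j$; fix such a basis. $\{\epsilon_j\}$ is the dual basis of $(\mathfrak a^{\mathbb C})^*$. $\Sigma$ is the set of restricted roots of $(\mathfrak g^{\mathbb C},\mathfrak a^{\mathbb C})$ (nonzero $\lambda\in(\mathfrak a^{\mathbb C})^*$ with $\{X\in\mathfrak g^{\mathbb C}:[H,X]=\lambda(H)X\ \forall H\in\mathfrak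 a^{\mathbb C}\}\ne0$); they are real on $i\mathfrak a$, and $\Sigma^+$ is the set of positive ones for the lexicographic order with respect to the basis $\{-iX_j\}$ of $i\mathfrak a$. For a linear form $\lambda$ on $\mathfrak a^{\mathbb C}$, $\mathfrak m_\lambda=\{\eta\in\mathfrak m:\operatorname{ad}_w^2\eta=\lambda^2(w)\eta\ \forall w\in\mathfrak a\}$; in particular $\mathfrak m_0=\mathfrak a$. *)

theory Defs
  imports "HOL-Analysis.Analysis"
begin

section \<open>Lie algebras\<close>

definition lie_bracket :: "('a::real_vector \<Rightarrow> 'a \<Rightarrow> 'a) \<Rightarrow> bool" where
  "lie_bracket br \<longleftrightarrow> bilinear br \<and> (\<forall>x. br x x = 0) \<and>
     (\<forall>x y z. br x (br y z) + br y (br z x) + br z (br x y) = 0)"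

definition lie_subalgebra :: "('a::real_vector \<Rightarrow> 'a \<Rightarrow> 'a) \<Rightarrow> 'a set \<Rightarrow> bool" where
  "lie_subalgebra br S \<longleftrightarrow> subspace S \<and> (\<forall>x\<in>S. \<forall>y\<in>S. br x y \<in> S)"

definition lie_ideal :: "('a::real_vector \<Rightarrow> 'a \<Rightarrow> 'a) \<Rightarrow> 'a set \<Rightarrow> bool" where
  "lie_ideal br J \<longleftrightarrow> subspace J \<and> (\<forall>x. \<forall>y\<in>J. br x y \<in> J)"

definition abelian :: "('a::real_vector \<Rightarrow> 'a \<Rightarrow> 'a) \<Rightarrow> 'a set \<Rightarrow> bool" where
  "abelian br S \<longleftrightarrow> (\<forall>x\<in>S. \<forall>y\<in>S. br x y = 0)"

definition simple_lie_algebra :: "('a::real_vector \<Rightarrow> 'a \<Rightarrow> 'a) \<Rightarrow> bool" where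
  "simple_lie_algebra br \<longleftrightarrow> lie_bracket br \<and> \<not> abelian br UNIV \<and>
     (\<forall>J. lie_ideal br J \<longrightarrow> J = {0} \<or> J = UNIV)"

definition center_of :: "('a::real_vector \<Rightarrow> 'a \<Rightarrow> 'a) \<Rightarrow> 'a set \<Rightarrow> 'a set" where
  "center_of br S = {z\<in>S. \<forall>x\<in>S. br z x = 0}"

definition exp_ad :: "('a::real_normed_vector \<Rightarrow> 'a \<Rightarrow> 'a) \<Rightarrow> 'a \<Rightarrow> 'a \<Rightarrow> 'a" where
  "exp_ad br x y = (\<Sum>n. (1 / fact n) *\<^sub>R (br x ^^ n) y)"

text \<open>
  The group \<open>Ad(G)\<close> of a connected Lie group \<open>G\<close> with Lie algebra \<open>br\<close>: such a \<open>G\<close> is generated by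
  the image of its exponential map, and \<open>Ad(exp x) = exp(ad x)\<close>. Closure under inverses is automatic,
  the inverse of \<open>exp(ad x)\<close> being \<open>exp(ad(-x))\<close>.
\<close>

inductive_set Ad_group :: "('a::real_normed_vector \<Rightarrow> 'a \<Rightarrow> 'a) \<Rightarrow> ('a \<Rightarrow> 'a) set"
  for br :: "'a \<Rightarrow> 'a \<Rightarrow> 'a" where
  id: "id \<in> Ad_group br"
| step: "\<phi> \<in> Ad_group br \<Longrightarrow> exp_ad br x \<circ> \<phi> \<in> Ad_group br"

definition Ad_invariant_inner :: "('a::euclidean_space \<Rightarrow> 'a \<Rightarrow> 'a) \<Rightarrow> bool" where
  "Ad_invariant_inner br \<longleftrightarrow> (\<forall>\<phi>\<in>Ad_group br. \<forall>x y. \<phi> x \<bullet> \<phi> y = x \<bullet> y)"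

section \<open>Irreducible Hermitian symmetric spaces of compact type\<close>

text \<open>
  The space \<open>G/K\<close> enters through its Lie algebra data. The ambient type is the Lie algebra \<open>\<gg>\<close>, its
  inner product is the \<open>Ad(G)\<close>-invariant form (whose existence makes \<open>\<gg>\<close> compact), \<open>K\<close> is the Lie
  algebra of the isotropy group, and the complex structure on \<open>M\<close> is \<open>I = br Z0\<close>. The identities
  \<open>[I\<xi>, I\<eta>] = [\<xi>, \<eta>]\<close> and \<open>I[\<zeta>, \<eta>] = [\<zeta>, I\<eta>]\<close> follow from \<open>Z0\<close> being central in \<open>K\<close> and the
  Jacobi identity.
\<close>

definition hermitian_symmetric_compact ::
    "('a::euclidean_space \<Rightarrow> 'a \<Rightarrow> 'a) \<Rightarrow> 'a set \<Rightarrow> 'a set \<Rightarrow> 'a \<Rightarrow> bool" where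
  "hermitian_symmetric_compact br K M Z0 \<longleftrightarrow>
     simple_lie_algebra br \<and> Ad_invariant_inner br \<and>
     lie_subalgebra br K \<and> subspace M \<and>
     K \<inter> M = {0} \<and> {x + y |x y. x \<in> K \<and> y \<in> M} = UNIV \<and>
     (\<forall>x\<in>K. \<forall>y\<in>M. x \<bullet> y = 0) \<and>
     (\<forall>x\<in>K. \<forall>y\<in>M. br x y \<in> M) \<and>
     (\<forall>x\<in>M. \<forall>y\<in>M. br x y \<in> K) \<and>
     dim (center_of br K) = 1 \<and> Z0 \<in> center_of br K \<and>
     (\<forall>\<xi>\<in>M. br Z0 (br Z0 \<xi>) = - \<xi>)"

definition cartan_subspace :: "('a::real_vector \<Rightarrow> 'a \<Rightarrow> 'a) \<Rightarrow> 'a set \<Rightarrow> 'a set \<Rightarrow> bool" where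
  "cartan_subspace br M A \<longleftrightarrow> subspace A \<and> A \<subseteq> M \<and> abelian br A \<and>
     (\<forall>B. subspace B \<and> B \<subseteq> M \<and> abelian br B \<and> A \<subseteq> B \<longrightarrow> B = A)"

text \<open>The basis \<open>X 1, \<dots>, X r\<close> of \<open>A\<close>, where \<open>r = dim A\<close>; values of \<open>X\<close> outside \<open>{1..r}\<close> are irrelevant.\<close>

definition adapted_basis ::
    "('a::real_vector \<Rightarrow> 'a \<Rightarrow> 'a) \<Rightarrow> 'a \<Rightarrow> 'a set \<Rightarrow> (nat \<Rightarrow> 'a) \<Rightarrow> bool" where
  "adapted_basis br Z0 A X \<longleftrightarrow>
     (let r = dim A; Y = (\<lambda>j. br Z0 (X j)); T = (\<lambda>j. br (X j) (Y j)) in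
       inj_on X {1..r} \<and> independent (X ` {1..r}) \<and> span (X ` {1..r}) = A \<and>
       (\<forall>j\<in>{1..r}. \<forall>k\<in>{1..r}.
          br (X j) (Y k) = (if j = k then T j else 0) \<and>
          br (T j) (X k) = (if j = k then Y j else 0) \<and>
          br (T j) (Y k) = (if j = k then - X j else 0)))"

section \<open>Complexification and restricted roots\<close>

text \<open>
  The complexification of a real vector space consists of pairs, \<open>(x, y)\<close> standing for \<open>x + iy\<close>;
  the complexification of a subspace \<open>S\<close> is \<open>S \<times> S\<close>.
\<close>

definition cscale :: "complex \<Rightarrow> 'a::real_vector \<times> 'a \<Rightarrow> 'a \<times> 'a" where
  "cscale c v = (Re c *\<^sub>R fst v - Im c *\<^sub>R snd v, Re c *\<^sub>R snd v + Im c *\<^sub>R fst v)"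

definition cbracket ::
    "('a::real_vector \<Rightarrow> 'a \<Rightarrow> 'a) \<Rightarrow> 'a \<times> 'a \<Rightarrow> 'a \<times> 'a \<Rightarrow> 'a \<times> 'a" where
  "cbracket br u v =
     (br (fst u) (fst v) - br (snd u) (snd v), br (fst u) (snd v) + br (snd u) (fst v))"

definition cembed :: "'a::real_vector \<Rightarrow> 'a \<times> 'a" where
  "cembed x = (x, 0)"

type_synonym 'a cform = "'a \<times> 'a \<Rightarrow> complex"

text \<open>
  The complex dual of \<open>A \<times> A\<close>. Forms are total functions, normalized to vanish outside \<open>A \<times> A\<close>, so that
  equality of functions is equality of forms, and linear combinations are taken pointwise.
\<close>

definition cdual :: "'a::real_vector set \<Rightarrow> 'a cform set" where
  "cdual A = {\<phi>. (\<forall>v. v \<notin> A \<times> A \<longrightarrow> \<phi> v = 0) \<and>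
     (\<forall>u\<in>A \<times> A. \<forall>v\<in>A \<times> A. \<phi> (u + v) = \<phi> u + \<phi> v) \<and>
     (\<forall>c. \<forall>v\<in>A \<times> A. \<phi> (cscale c v) = c * \<phi> v)}"

definition dual_basis :: "'a::real_vector set \<Rightarrow> (nat \<Rightarrow> 'a) \<Rightarrow> (nat \<Rightarrow> 'a cform) \<Rightarrow> bool" where
  "dual_basis A X \<epsilon> \<longleftrightarrow> (\<forall>j\<in>{1..dim A}. \<epsilon> j \<in> cdual A \<and>
     (\<forall>k\<in>{1..dim A}. \<epsilon> j (cembed (X k)) = (if j = k then 1 else 0)))"

definition root_space ::
    "('a::real_vector \<Rightarrow> 'a \<Rightarrow> 'a) \<Rightarrow> 'a set \<Rightarrow> 'a cform \<Rightarrow> ('a \<times> 'a) set" where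
  "root_space br A \<alpha> = {V. \<forall>H\<in>A \<times> A. cbracket br H V = cscale (\<alpha> H) V}"

definition restricted_roots :: "('a::real_vector \<Rightarrow> 'a \<Rightarrow> 'a) \<Rightarrow> 'a set \<Rightarrow> 'a cform set" where
  "restricted_roots br A = {\<alpha>\<in>cdual A. \<alpha> \<noteq> (\<lambda>_. 0) \<and> root_space br A \<alpha> \<noteq> {0}}"

text \<open>
  Positivity for the lexicographic order with respect to the basis \<open>-iX 1, \<dots>, -iX r\<close> of \<open>iA\<close>: the first
  nonzero coordinate is positive. The coordinates of a restricted root are real, so \<open>Re\<close> only
  converts the type.
\<close>

definition lex_positive :: "'a::real_vector set \<Rightarrow> (nat \<Rightarrow> 'a) \<Rightarrow> 'a cform \<Rightarrow> bool" where
  "lex_positive A X \<alpha> \<longleftrightarrow> (\<exists>j\<in>{1..dim A}.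
     (\<forall>k\<in>{1..<j}. \<alpha> (cscale (- \<i>) (cembed (X k))) = 0) \<and>
     Re (\<alpha> (cscale (- \<i>) (cembed (X j)))) > 0)"

definition positive_roots ::
    "('a::real_vector \<Rightarrow> 'a \<Rightarrow> 'a) \<Rightarrow> 'a set \<Rightarrow> (nat \<Rightarrow> 'a) \<Rightarrow> 'a cform set" where
  "positive_roots br A X = {\<alpha>\<in>restricted_roots br A. lex_positive A X \<alpha>}"

text \<open>The defining equation is read in the complexification, since \<open>\<alpha>(w)\<^sup>2\<close> is a complex number for general \<open>\<alpha>\<close>.\<close>

definition m_space ::
    "('a::real_vector \<Rightarrow> 'a \<Rightarrow> 'a) \<Rightarrow> 'a set \<Rightarrow> 'a set \<Rightarrow> 'a cform \<Rightarrow> 'a set" where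
  "m_space br M A \<alpha> = {\<eta>\<in>M. \<forall>w\<in>A.
     cembed (br w (br w \<eta>)) = cscale ((\<alpha> (cembed w))\<^sup>2) (cembed \<eta>)}"

definition BC_pos :: "nat \<Rightarrow> (nat \<Rightarrow> 'a cform) \<Rightarrow> 'a cform set" where
  "BC_pos r \<epsilon> =
     {(\<lambda>v. \<i>/2 * \<epsilon> j v) |j. 1 \<le> j \<and> j \<le> r} \<union>
     {(\<lambda>v. \<i> * \<epsilon> j v) |j. 1 \<le> j \<and> j \<le> r} \<union>
     {(\<lambda>v. \<i>/2 * (\<epsilon> p v + \<epsilon> k v)) |p k. 1 \<le> p \<and> p < k \<and> k \<le> r} \<union>
     {(\<lambda>v. \<i>/2 * (\<epsilon> p v - \<epsilon> k v)) |p k. 1 \<le> p \<and> p < k \<and> k \<le> r}"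

definition BC_pairs :: "nat \<Rightarrow> (nat \<Rightarrow> 'a cform) \<Rightarrow> ('a cform \<times> 'a cform) set" where
  "BC_pairs r \<epsilon> =
     {((\<lambda>v. \<i>/2 * \<epsilon> j v), (\<lambda>v. \<i>/2 * \<epsilon> j v)) |j. 1 \<le> j \<and> j \<le> r} \<union>
     {((\<lambda>v. \<i> * \<epsilon> j v), (\<lambda>v. 0)) |j. 1 \<le> j \<and> j \<le> r} \<union>
     {((\<lambda>v. \<i>/2 * (\<epsilon> p v + \<epsilon> k v)), (\<lambda>v. \<i>/2 * (\<epsilon> p v - \<epsilon> k v))) |p k. 1 \<le> p \<and> p < k \<and> k \<le> r} \<union>
     {((\<lambda>v. \<i>/2 * (\<epsilon> p v - \<epsilon> k v)), (\<lambda>v. \<i>/2 * (\<epsilon> p v + \<epsilon> k v))) |p k. 1 \<le> p \<and> p < k \<and> k \<le> r}"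

end

(*
  Write ad W for the operator [W, -] and call W cubic if (ad W)^3 = - ad W, so that ad W has
  eigenvalues 0, i, -i. Since ad Z0 is 0 on k and squares to -1 on m, the element Z0 is cubic.
  Put Z = Z0 - (T_1 + ... + T_r); it commutes with all X_j and Y_j. The rotations generated by the
  Y_j turn T_j into +X_j or -X_j and fix Z, so Z + s_1 X_1 + ... + s_r X_r is cubic for all signs s_j.
  If [X_j, V] = i c_j V for all j, V can be chosen to be an eigenvector of ad Z too, say for i n, and then
  n + s_1 c_1 + ... + s_r c_r is in {-1, 0, 1} for all signs. Hence c_j is real, 2 c_j is an integer
  and |c_1| + ... + |c_r| <= 1, which leaves only the roots in (BC)_r. If the sum equals 1, ad Z
  annihilates the weight space. Finally Y_j + i s T_j lowers the j-th weight by s, and most of these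
  shifts leave the region |c_1| + ... + |c_r| <= 1; so I = ad Z + ad T_1 + ... + ad T_r maps the
  vectors of m of weight +-c into a single m_lambda.
*)
theory Submission
  imports Defs
begin

section \<open>Cubic elements\<close>

definition cubic :: "('a::real_vector \<Rightarrow> 'a \<Rightarrow> 'a) \<Rightarrow> 'a \<Rightarrow> bool" where
  "cubic br W \<longleftrightarrow> (\<forall>v. br W (br W (br W v)) = - br W v)"

locale lie_alg =
  fixes br :: "'a::euclidean_space \<Rightarrow> 'a \<Rightarrow> 'a"
  assumes lie: "lie_bracket br"
begin

sublocale bounded_bilinear br
  using lie unfolding lie_bracket_def by (simp add: bilinear_conv_bounded_bilinear)

lemma self [simp]: "br x x = 0"
  using lie unfolding lie_bracket_def by blast

lemma anti: "br x y = - br y x"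
proof -
  have "br (x + y) (x + y) = br x y + br y x"
    by (subst add_left) (simp add: add_right)
  then have "br x y + br y x = 0" by simp
  then show ?thesis by (simp add: eq_neg_iff_add_eq_0)
qed

lemma deriv: "br x (br y z) = br (br x y) z + br y (br x z)"
proof -
  have "br x (br y z) + br y (br z x) + br z (br x y) = 0"
    using lie unfolding lie_bracket_def by blast
  moreover have "br z x = - br x z" "br z (br x y) = - br (br x y) z" by (rule anti)+
  ultimately show ?thesis by (simp add: minus_right algebra_simps)
qed

lemma commute_ops:
  assumes "br x y = 0" shows "br x (br y z) = br y (br x z)"
  using deriv[of x y z] assms by (simp add: zero_left)

text \<open>
  \<open>U + cos \<theta> T + sin \<theta> X\<close> is moved along the flow of \<open>ad Y\<close>, so its defect \<open>G \<theta>\<close> from being cubic satisfies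
  the linear equation \<open>G' = [ad Y, G]\<close>; as \<open>G 0 = 0\<close>, a Gronwall estimate for the squared
  Hilbert-Schmidt norm gives \<open>G = 0\<close>. This avoids showing that \<open>exp (ad Y)\<close> is an automorphism.
\<close>

lemma cubic_rotation:
  assumes YU: "br Y U = 0" and YT: "br Y T = X" and YX: "br Y X = - T"
    and cubic: "cubic br (U + T)"
  shows "cubic br (U + X)"
proof -
  define W where "W \<theta> = U + cos \<theta> *\<^sub>R T + sin \<theta> *\<^sub>R X" for \<theta>
  define G where "G \<theta> v = br (W \<theta>) (br (W \<theta>) (br (W \<theta>) v)) + br (W \<theta>) v" for \<theta> v
  have W': "(W has_vector_derivative br Y (W \<theta>)) (at \<theta>)" for \<theta>
  proof -
    have "br Y (W \<theta>) = - sin \<theta> *\<^sub>R T + cos \<theta> *\<^sub>R X"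
      by (simp add: W_def add_right scaleR_right YU YT YX)
    moreover have "(W has_vector_derivative - sin \<theta> *\<^sub>R T + cos \<theta> *\<^sub>R X) (at \<theta>)"
      unfolding W_def has_vector_derivative_def
      by (auto intro!: derivative_eq_intros ext simp: algebra_simps)
    ultimately show ?thesis by simp
  qed
  have G': "((\<lambda>\<theta>. G \<theta> v) has_vector_derivative br Y (G \<theta> v) - G \<theta> (br Y v)) (at \<theta>)" for \<theta> v
  proof -
    note D = has_vector_derivative[OF W']
    have 1: "((\<lambda>\<theta>. br (W \<theta>) v) has_vector_derivative br (br Y (W \<theta>)) v) (at \<theta>)"
      using D[OF has_vector_derivative_const[of v]] by (simp add: zero_right)
    have 2: "((\<lambda>\<theta>. br (W \<theta>) (br (W \<theta>) v)) has_vector_derivative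
        br (W \<theta>) (br (br Y (W \<theta>)) v) + br (br Y (W \<theta>)) (br (W \<theta>) v)) (at \<theta>)"
      by (rule D[OF 1])
    have 3: "((\<lambda>\<theta>. G \<theta> v) has_vector_derivative
        (br (W \<theta>) (br (W \<theta>) (br (br Y (W \<theta>)) v) + br (br Y (W \<theta>)) (br (W \<theta>) v))
         + br (br Y (W \<theta>)) (br (W \<theta>) (br (W \<theta>) v))) + br (br Y (W \<theta>)) v) (at \<theta>)"
      unfolding G_def by (rule has_vector_derivative_add[OF D[OF 2] 1])
    \<comment> \<open>With ad of the derivative of \<open>W\<close> written as the commutator of ad
      Y and ad W, the product-rule terms telescope to the commutator of ad Y with the whole
      defect.\<close>
    have e: "br (br Y w) z = br Y (br w z) - br w (br Y z)" for w z
      using deriv[of Y w z] by simp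
    show ?thesis
      using 3 by (simp add: G_def e add_right diff_right algebra_simps)
  qed
  define C where "C = (SOME C. \<forall>v. norm (br Y v) \<le> norm v * C)"
  have C: "norm (br Y v) \<le> norm v * C" for v
    unfolding C_def using someI_ex[OF bounded_linear.bounded[OF bounded_linear_right[of Y]]] by blast
  have C0: "C \<ge> 0"
    using C[of "SOME i. i \<in> Basis"] norm_ge_zero[of "br Y (SOME i. i \<in> Basis)"]
    by (metis SOME_Basis mult_1 norm_Basis order_trans)
  have linG: "linear (G \<theta>)" for \<theta>
    unfolding G_def by (rule linearI) (simp_all add: add_right scaleR_right algebra_simps)
  define \<phi> where "\<phi> \<theta> = (\<Sum>b\<in>Basis. G \<theta> b \<bullet> G \<theta> b)" for \<theta>
  define \<phi>' where "\<phi>' \<theta> = (\<Sum>b\<in>Basis. 2 * (G \<theta> b \<bullet> (br Y (G \<theta> b) - G \<theta> (br Y b))))" for \<theta>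
  \<comment> \<open>The Gronwall constant: \<open>br Y (G \<theta> b)\<close> contributes 2C.
    Expanding \<open>br Y b\<close> in the basis, and bounding the squared sum of norms by DIM times
    the sum of squares, contributes the rest.\<close>
  define k where "k = 2 * C + 2 * C * real DIM('a)"
  have phi': "(\<phi> has_real_derivative \<phi>' \<theta>) (at \<theta>)" for \<theta>
    unfolding \<phi>_def \<phi>'_def
  proof (rule DERIV_sum)
    fix b :: 'a
    have "((\<lambda>\<theta>. G \<theta> b \<bullet> G \<theta> b) has_vector_derivative
       G \<theta> b \<bullet> (br Y (G \<theta> b) - G \<theta> (br Y b)) + (br Y (G \<theta> b) - G \<theta> (br Y b)) \<bullet> G \<theta> b) (at \<theta>)"
      by (rule bounded_bilinear.has_vector_derivative[OF bounded_bilinear_inner G' G'])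
    then show "((\<lambda>\<theta>. G \<theta> b \<bullet> G \<theta> b) has_real_derivative
       2 * (G \<theta> b \<bullet> (br Y (G \<theta> b) - G \<theta> (br Y b)))) (at \<theta>)"
      by (simp add: has_real_derivative_iff_has_vector_derivative inner_commute)
  qed
  have bound: "\<phi>' \<theta> \<le> k * \<phi> \<theta>" for \<theta>
  proof -
    define S where "S = (\<Sum>b\<in>Basis. norm (G \<theta> b))"
    have phin: "\<phi> \<theta> = (\<Sum>b\<in>Basis. (norm (G \<theta> b))\<^sup>2)"
      by (simp add: \<phi>_def dot_square_norm)
    have GY: "norm (G \<theta> (br Y b)) \<le> C * S" if "b \<in> Basis" for b
    proof -
      have "G \<theta> (br Y b) = G \<theta> (\<Sum>i\<in>Basis. (br Y b \<bullet> i) *\<^sub>R i)"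
        by (simp add: euclidean_representation)
      also have "\<dots> = (\<Sum>i\<in>Basis. (br Y b \<bullet> i) *\<^sub>R G \<theta> i)"
        by (simp add: linear_sum[OF linG] linear_scale[OF linG])
      also have "norm \<dots> \<le> (\<Sum>i\<in>Basis. C * norm (G \<theta> i))"
      proof (rule sum_norm_le)
        fix i :: 'a assume "i \<in> Basis"
        then have "\<bar>br Y b \<bullet> i\<bar> \<le> norm (br Y b)" by (rule Basis_le_norm)
        also have "\<dots> \<le> C" using C[of b] that by simp
        finally show "norm ((br Y b \<bullet> i) *\<^sub>R G \<theta> i) \<le> C * norm (G \<theta> i)"
          by (simp add: mult_right_mono)
      qed
      finally show ?thesis by (simp add: S_def sum_distrib_left)
    qed
    have "\<phi>' \<theta> \<le> (\<Sum>b\<in>Basis. 2 * C * (norm (G \<theta> b))\<^sup>2 + 2 * C * S * norm (G \<theta> b))"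
      unfolding \<phi>'_def
    proof (rule sum_mono)
      fix b :: 'a assume b: "b \<in> Basis"
      have "G \<theta> b \<bullet> (br Y (G \<theta> b) - G \<theta> (br Y b))
        \<le> norm (G \<theta> b) * norm (br Y (G \<theta> b) - G \<theta> (br Y b))"
        by (rule norm_cauchy_schwarz)
      also have "\<dots> \<le> norm (G \<theta> b) * (norm (G \<theta> b) * C + C * S)"
        by (intro mult_left_mono order_trans[OF norm_triangle_ineq4] add_mono C GY b) auto
      finally show "2 * (G \<theta> b \<bullet> (br Y (G \<theta> b) - G \<theta> (br Y b)))
          \<le> 2 * C * (norm (G \<theta> b))\<^sup>2 + 2 * C * S * norm (G \<theta> b)"
        by (simp add: power2_eq_square algebra_simps)
    qed
    also have "\<dots> = 2 * C * \<phi> \<theta> + 2 * C * S\<^sup>2"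
      by (simp add: sum.distrib phin flip: sum_distrib_left S_def) (simp add: power2_eq_square)
    also have "\<dots> \<le> 2 * C * \<phi> \<theta> + 2 * C * (real DIM('a) * \<phi> \<theta>)"
    proof -
      have "S\<^sup>2 \<le> real DIM('a) * \<phi> \<theta>"
        unfolding S_def phin using sum_squared_le_sum_of_squares[of "\<lambda>b. norm (G \<theta> b)" "Basis::'a set"]
        by (simp add: mult.commute)
      then show ?thesis using C0 by (simp add: mult_left_mono)
    qed
    finally show ?thesis by (simp add: k_def algebra_simps)
  qed
  have W0: "W 0 = U + T" and W1: "W (pi/2) = U + X" by (simp_all add: W_def)
  \<comment> \<open>Multiplying by exp(-k \<theta>) makes the nonnegative \<open>\<phi>\<close>
    nonincreasing, so its zero at 0 persists up to pi/2, where \<open>W\<close> has reached U +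
    X.\<close>
  have "\<phi> (pi/2) * exp (- k * (pi/2)) \<le> \<phi> 0 * exp (- k * 0)"
  proof (rule DERIV_nonpos_imp_nonincreasing[where f="\<lambda>\<theta>. \<phi> \<theta> * exp (- k * \<theta>)"])
    fix \<theta> :: real
    have "((\<lambda>\<theta>. \<phi> \<theta> * exp (- k * \<theta>)) has_real_derivative
        (\<phi>' \<theta> - k * \<phi> \<theta>) * exp (- k * \<theta>)) (at \<theta>)"
      by (auto intro!: derivative_eq_intros phi' simp: algebra_simps)
    moreover have "(\<phi>' \<theta> - k * \<phi> \<theta>) * exp (- k * \<theta>) \<le> 0"
      using bound[of \<theta>] by (simp add: mult_nonpos_nonneg)
    ultimately show "\<exists>y. ((\<lambda>\<theta>. \<phi> \<theta> * exp (- k * \<theta>)) has_real_derivative y) (at \<theta>) \<and> y \<le> 0"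
      by blast
  qed simp
  moreover have "\<phi> 0 = 0"
    using cubic by (simp add: \<phi>_def G_def W0 cubic_def)
  ultimately have "\<phi> (pi/2) \<le> 0"
    by (simp add: mult_le_0_iff)
  moreover have "\<phi> (pi/2) \<ge> 0" by (simp add: \<phi>_def sum_nonneg)
  ultimately have "\<phi> (pi/2) = 0" by simp
  then have Gb: "G (pi/2) b = 0" if "b \<in> Basis" for b
    using that unfolding \<phi>_def by (subst (asm) sum_nonneg_eq_0_iff) auto
  have "G (pi/2) v = 0" for v
    using linear_eq_on_span[OF linG module_hom_zero, of Basis] Gb span_Basis by blast
  then show ?thesis
    by (simp add: cubic_def G_def W1 eq_neg_iff_add_eq_0)
qed

text \<open>
  The even part of \<open>(z + x)\<^sup>3 + (z + x) = 0 = (z - x)\<^sup>3 + (z - x)\<close> in \<open>x\<close> is \<open>z\<^sup>3 - 2 z = 0\<close> and the odd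
  part is \<open>z\<^sup>2 x = 0\<close>, once \<open>x\<^sup>2 = -1\<close>.
\<close>

lemma commuting_cubic_vanish:
  assumes zx: "br z x = 0" and p: "cubic br (z + x)" and m: "cubic br (z - x)"
    and x2: "br x (br x v) = - v"
  shows "br z v = 0"
proof -
  have c: "br x (br z u) = br z (br x u)" for u
    using commute_ops[OF zx, of u] by simp
  have P: "br (z + x) (br (z + x) (br (z + x) u)) = - br (z + x) u"
    and N: "br (z - x) (br (z - x) (br (z - x) u)) = - br (z - x) u" for u
    using p m by (auto simp: cubic_def)
  have six: "6 *\<^sub>R a = a + a + a + a + a + a" for a :: 'a
  proof -
    have "6 *\<^sub>R a = (1 + 1 + 1 + 1 + 1 + 1 :: real) *\<^sub>R a" by simp
    then show ?thesis by (simp only: scaleR_left_distrib scaleR_one)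
  qed
  have "br (z + x) (br (z + x) (br (z + x) v)) - br (z - x) (br (z - x) (br (z - x) v))
     = 6 *\<^sub>R br z (br z (br x v)) - (br x v + br x v)"
    unfolding six by (simp add: add_left add_right diff_left diff_right c x2 minus_right)
  then have "6 *\<^sub>R br z (br z (br x v)) = 0"
    unfolding P N by (simp add: add_left diff_left)
  \<comment> \<open>Since x squares to -1 only on v, one more x is applied and moved inward past the
    z's.\<close>
  then have "br x (br z (br z (br x v))) = 0" by (simp add: zero_right)
  then have z2: "br z (br z v) = 0" by (simp add: c x2 minus_right)
  have "br (z + x) (br (z + x) (br (z + x) v)) + br (z - x) (br (z - x) (br (z - x) v))
     = br z (br z (br z v)) + br z (br z (br z v)) - 6 *\<^sub>R br z v"
    unfolding six by (simp add: add_left add_right diff_left diff_right c x2 minus_right)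
  \<comment> \<open>As z^2 v = 0, the z^3 terms drop out of the even part and two different
    multiples of z v are left.\<close>
  then have "- (2 *\<^sub>R br z v) = - (6 *\<^sub>R br z v)"
    unfolding P N z2 by (simp add: add_left diff_left zero_right scaleR_2)
  then show ?thesis by simp
qed

end

section \<open>Joint eigenvalues of an adapted basis\<close>

lemma cscale_one: "cscale 1 V = V"
  by (simp add: cscale_def)

lemma cscale_cscale: "cscale a (cscale b V) = cscale (a * b) V"
  by (simp add: cscale_def algebra_simps)

lemma cscale_add_left: "cscale (a + b) V = cscale a V + cscale b V"
  by (simp add: cscale_def algebra_simps)

lemma cscale_add_right: "cscale a (U + V) = cscale a U + cscale a V"
  by (simp add: cscale_def algebra_simps)

lemma cscale_diff_right: "cscale a (U - V) = cscale a U - cscale a V"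
  by (simp add: cscale_def algebra_simps)

lemma cscale_zero_left: "cscale 0 V = 0"
  by (simp add: cscale_def zero_prod_def)

lemma cscale_zero_right: "cscale a 0 = 0"
  by (simp add: cscale_def zero_prod_def)

lemma cscale_uminus_left: "cscale (- a) V = - cscale a V"
  by (simp add: cscale_def)

lemma cscale_eq_0: "cscale a V = 0 \<longleftrightarrow> a = 0 \<or> V = 0"
proof
  assume *: "cscale a V = 0"
  have "V = 0" if "a \<noteq> 0"
  proof -
    have "V = cscale (inverse a) (cscale a V)" using that by (simp add: cscale_cscale cscale_one)
    then show ?thesis by (simp add: * cscale_zero_right)
  qed
  then show "a = 0 \<or> V = 0" by blast
qed (auto simp: cscale_zero_left cscale_zero_right)

lemma cscale_inj: "cscale a V = cscale b V \<Longrightarrow> V \<noteq> 0 \<Longrightarrow> a = b"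
  using cscale_eq_0[of "a - b" V] cscale_add_left[of "a - b" b V] by simp

lemma sum_abs_update:
  fixes c :: "nat \<Rightarrow> real"
  assumes "finite J" "p \<in> J"
  shows "(\<Sum>j\<in>J. \<bar>(c(p := a)) j\<bar>) = (\<Sum>j\<in>J. \<bar>c j\<bar>) - \<bar>c p\<bar> + \<bar>a\<bar>"
proof -
  have "(\<Sum>j\<in>J - {p}. \<bar>(c(p := a)) j\<bar>) = (\<Sum>j\<in>J - {p}. \<bar>c j\<bar>)" by (rule sum.cong) auto
  then show ?thesis using assms by (simp add: sum.remove[of J p])
qed

text \<open>Reversing one sign changes the sum by 2 a_j, so a_j is half a difference of two elements
  of {0, i, -i}. Signs with s_j c_j = |c_j| and their negatives give two such elements that differ
  by 2i times the sum of the |c_j|, while any difference has modulus at most 2.\<close>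

lemma sign_sums_bound:
  fixes a :: "nat \<Rightarrow> complex"
  assumes fin: "finite J"
    and nu: "\<And>s :: nat \<Rightarrow> real. (\<And>j. s j = 1 \<or> s j = - 1) \<Longrightarrow>
       \<nu> + (\<Sum>j\<in>J. of_real (s j) * a j) \<in> {0, \<i>, - \<i>}"
  obtains c :: "nat \<Rightarrow> real" where "\<And>j. j \<in> J \<Longrightarrow> a j = \<i> * of_real (c j)"
    "\<And>j. j \<in> J \<Longrightarrow> c j \<in> {0, 1/2, - 1/2, 1, - 1}" "(\<Sum>j\<in>J. \<bar>c j\<bar>) \<le> 1"
proof -
  define c where "c j = Im (a j)" for j
  have ac: "a p = \<i> * of_real (c p) \<and> c p \<in> {0, 1/2, - 1/2, 1, - 1}" if p: "p \<in> J" for p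
  proof -
    let ?s = "(\<lambda>_. 1)(p := - 1) :: nat \<Rightarrow> real"
    define R where "R = \<nu> + sum a (J - {p})"
    have "R + a p \<in> {0, \<i>, - \<i>}"
      using nu[of "\<lambda>_. 1"] fin p by (simp add: sum.remove R_def algebra_simps)
    moreover have e: "(\<Sum>j\<in>J. of_real (?s j) * a j) = - a p + sum a (J - {p})"
      using fin p by (simp add: sum.remove)
    have "\<nu> + (\<Sum>j\<in>J. of_real (?s j) * a j) \<in> {0, \<i>, - \<i>}" by (rule nu) simp
    then have "R - a p \<in> {0, \<i>, - \<i>}"
      unfolding e by (simp add: R_def algebra_simps)
    ultimately have "2 * a p \<in> {0, \<i>, - \<i>, 2 * \<i>, - 2 * \<i>}"
      by (auto simp: complex_eq_iff)
    then show ?thesis by (auto simp: c_def complex_eq_iff)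
  qed
  have "(\<Sum>j\<in>J. \<bar>c j\<bar>) \<le> 1"
  proof -
    define s where "s j = (if c j < 0 then - 1 else 1 :: real)" for j
    have e: "(\<Sum>j\<in>J. of_real (s j) * a j) = \<i> * of_real (\<Sum>j\<in>J. \<bar>c j\<bar>)"
      unfolding of_real_sum sum_distrib_left using ac by (intro sum.cong) (auto simp: s_def)
    have e': "(\<Sum>j\<in>J. of_real (- s j) * a j) = - \<i> * of_real (\<Sum>j\<in>J. \<bar>c j\<bar>)"
      using e by (simp add: sum_negf)
    have "\<nu> + \<i> * of_real (\<Sum>j\<in>J. \<bar>c j\<bar>) \<in> {0, \<i>, - \<i>}"
      using nu[of s] unfolding e by (simp add: s_def)
    moreover have "\<nu> + - \<i> * of_real (\<Sum>j\<in>J. \<bar>c j\<bar>) \<in> {0, \<i>, - \<i>}"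
      using nu[of "\<lambda>j. - s j"] unfolding e' by (simp add: s_def)
    ultimately show ?thesis by (auto simp: complex_eq_iff)
  qed
  then show ?thesis using that ac by blast
qed

section \<open>The triples X_j, Y_j, T_j with so(3) relations, and the cubic elements built from
  them\<close>

locale adapted = lie_alg +
  fixes Z0 :: 'a and X :: "nat \<Rightarrow> 'a" and J :: "nat set" and Y T :: "nat \<Rightarrow> 'a"
  assumes Y_def: "Y j = br Z0 (X j)"
    and finite_J: "finite J"
    and cubic_Z0: "cubic br Z0"
    and Z0_Y: "j \<in> J \<Longrightarrow> br Z0 (Y j) = - X j"
    and X_X: "j \<in> J \<Longrightarrow> k \<in> J \<Longrightarrow> br (X j) (X k) = 0"
    and X_Y: "j \<in> J \<Longrightarrow> k \<in> J \<Longrightarrow> br (X j) (Y k) = (if j = k then T j else 0)"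
    and T_X: "j \<in> J \<Longrightarrow> k \<in> J \<Longrightarrow> br (T j) (X k) = (if j = k then Y j else 0)"
    and T_Y: "j \<in> J \<Longrightarrow> k \<in> J \<Longrightarrow> br (T j) (Y k) = (if j = k then - X j else 0)"
begin

text \<open>Subtracting the T_j cancels the action of Z0 on the triples: for k in J, both Z0 and T_k
  send X_k to Y_k and Y_k to -X_k.\<close>

definition Z :: 'a where
  "Z = Z0 - (\<Sum>j\<in>J. T j)"

definition W :: "(nat \<Rightarrow> real) \<Rightarrow> 'a" where
  "W s = Z + (\<Sum>j\<in>J. s j *\<^sub>R X j)"

lemma X_T: "j \<in> J \<Longrightarrow> k \<in> J \<Longrightarrow> br (X k) (T j) = (if j = k then - Y j else 0)"
  using T_X[of j k] anti[of "X k" "T j"] by auto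

lemma Y_T: "j \<in> J \<Longrightarrow> k \<in> J \<Longrightarrow> br (Y k) (T j) = (if j = k then X j else 0)"
  using T_Y[of j k] anti[of "Y k" "T j"] by auto

lemma Y_X: "j \<in> J \<Longrightarrow> k \<in> J \<Longrightarrow> br (Y k) (X j) = (if j = k then - T j else 0)"
  using X_Y[of j k] anti[of "Y k" "X j"] by auto

lemma X_Z: assumes "k \<in> J" shows "br (X k) Z = 0"
proof -
  have "br (X k) (\<Sum>j\<in>J. T j) = - Y k"
    using assms finite_J by (simp add: sum_right X_T)
  then show ?thesis using anti[of "X k" Z0] by (simp add: Z_def diff_right Y_def)
qed

lemma Y_Z: assumes "k \<in> J" shows "br (Y k) Z = 0"
proof -
  have "br (Y k) (\<Sum>j\<in>J. T j) = X k"
    using assms finite_J by (simp add: sum_right Y_T)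
  then show ?thesis using anti[of "Y k" Z0] Z0_Y[OF assms] by (simp add: Z_def diff_right)
qed

text \<open>The T_p in Z0 = Z + sum of the T_j are turned into s_p X_p one at a time by
  \<open>cubic_rotation\<close>; the induction runs over the set S of indices already
  turned.\<close>

lemma cubic_W:
  assumes s: "\<And>j. s j = 1 \<or> s j = - 1"
  shows "cubic br (W s)"
proof -
  have "cubic br (Z + (\<Sum>j\<in>S. s j *\<^sub>R X j) + (\<Sum>j\<in>J - S. T j))" if "S \<subseteq> J" for S
    using finite_subset[OF that finite_J] that
  proof (induction S rule: finite_induct)
    case empty
    show ?case using cubic_Z0 by (simp add: Z_def)
  next
    case (insert p S)
    let ?U = "Z + (\<Sum>j\<in>S. s j *\<^sub>R X j) + (\<Sum>j\<in>J - insert p S. T j)"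
    have p: "p \<in> J" and SJ: "S \<subseteq> J" using insert by auto
    have "br (Y p) (\<Sum>j\<in>S. s j *\<^sub>R X j) = 0"
      unfolding sum_right using SJ insert.hyps p
      by (intro sum.neutral) (auto simp: scaleR_right Y_X subset_iff)
    moreover have "br (Y p) (\<Sum>j\<in>J - insert p S. T j) = 0"
      unfolding sum_right using p by (intro sum.neutral) (auto simp: Y_T)
    ultimately have YU: "br (s p *\<^sub>R Y p) ?U = 0"
      by (simp add: add_right scaleR_left Y_Z[OF p])
    have JS: "J - S = insert p (J - insert p S)" using p insert.hyps by auto
    have "(\<Sum>j\<in>J - S. T j) = T p + (\<Sum>j\<in>J - insert p S. T j)"
      by (subst JS, subst sum.insert) (use finite_J in auto)
    then have "cubic br (?U + T p)"
      using insert.IH[OF SJ] by (simp add: algebra_simps)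
    moreover have "br (s p *\<^sub>R Y p) (T p) = s p *\<^sub>R X p"
      using p by (simp add: scaleR_left Y_T)
    \<comment> \<open>Here (s_p)^2 = 1 is what makes s_p Y_p rotate the plane of T_p and s_p X_p
      with unit speed.\<close>
    moreover have "br (s p *\<^sub>R Y p) (s p *\<^sub>R X p) = - T p"
      using p s[of p] by (auto simp: scaleR_left scaleR_right minus_left minus_right Y_X)
    ultimately have "cubic br (?U + s p *\<^sub>R X p)"
      using cubic_rotation[OF YU] by blast
    then show ?case using insert.hyps by (simp add: algebra_simps)
  qed
  from this[of J] show ?thesis by (simp add: W_def)
qed

text \<open>The complex-linear extension of ad w, for real w, to pairs x + iy.\<close>

definition cact :: "'a \<Rightarrow> 'a \<times> 'a \<Rightarrow> 'a \<times> 'a" where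
  "cact w V = (br w (fst V), br w (snd V))"

lemma cact_add: "cact w (U + V) = cact w U + cact w V"
  and cact_diff: "cact w (U - V) = cact w U - cact w V"
  and cact_add_left: "cact (w + w') V = cact w V + cact w' V"
  and cact_diff_left: "cact (w - w') V = cact w V - cact w' V"
  and cact_cscale: "cact w (cscale a V) = cscale a (cact w V)"
  and cact_scaleR: "cact (t *\<^sub>R w) V = cscale (of_real t) (cact w V)"
  by (simp_all add: cact_def cscale_def add_right add_left diff_left diff_right scaleR_left scaleR_right)

lemma cact_commute:
  assumes "br x y = 0" shows "cact x (cact y V) = cact y (cact x V)"
  using commute_ops[OF assms] by (simp add: cact_def)

lemma cact_sum:
  assumes "\<And>j. j \<in> J \<Longrightarrow> cact (X j) V = cscale (a j) V"
  shows "cact (\<Sum>j\<in>J. s j *\<^sub>R X j) V = cscale (\<Sum>j\<in>J. of_real (s j) * a j) V"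
  using finite_J assms
  by (induction J rule: finite_induct)
    (simp_all add: cact_add_left cact_scaleR cscale_cscale cscale_add_left,
     simp add: cact_def cscale_def zero_left)

text \<open>Z commutes with all X_j, so inside their joint eigenspace E there is an eigenvector of Z
  as well. On it every \<open>W s\<close> acts by a scalar satisfying t^3 = -t, and
  \<open>sign_sums_bound\<close> applies.\<close>

lemma joint_eigenvalues:
  assumes V: "\<And>j. j \<in> J \<Longrightarrow> cact (X j) V = cscale (a j) V" and "V \<noteq> 0"
  obtains c :: "nat \<Rightarrow> real" where "\<And>j. j \<in> J \<Longrightarrow> a j = \<i> * of_real (c j)"
    "\<And>j. j \<in> J \<Longrightarrow> c j \<in> {0, 1/2, - 1/2, 1, - 1}" "(\<Sum>j\<in>J. \<bar>c j\<bar>) \<le> 1"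
proof -
  define E where "E = {V. \<forall>j\<in>J. cact (X j) V = cscale (a j) V}"
  define w where "w = W (\<lambda>_. 1)"
  have XW: "br (X j) (W s) = 0" if "j \<in> J" for j s
    unfolding W_def using that X_Z X_X by (simp add: add_right sum_right scaleR_right)
  have E_w: "cact w U \<in> E" if "U \<in> E" for U
    using that cact_commute[OF XW] unfolding E_def w_def by (simp add: cact_cscale)
  have E_lin: "U + cscale t U' \<in> E" if "U \<in> E" "U' \<in> E" for U U' t
    using that unfolding E_def by (simp add: cact_add cact_cscale cscale_add_right cscale_cscale mult.commute)
  have cub: "cact (W s) (cact (W s) (cact (W s) U)) = - cact (W s) U" if "\<And>j. s j = 1 \<or> s j = - 1" for s U
    using cubic_W[OF that] by (simp add: cubic_def cact_def)
  have "V \<in> E" using V by (simp add: E_def)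
  \<comment> \<open>The eigenvector comes from factoring t^3 + t. If U = wV is nonzero then w^2 U =
    -U, so (w - i)U is an eigenvector for -i unless it vanishes, and then U itself is one for
    i.\<close>
  have "\<exists>V'\<in>E. V' \<noteq> 0 \<and> (\<exists>\<mu>. cact w V' = cscale \<mu> V')"
  proof (cases "cact w V = 0")
    case True
    then show ?thesis using \<open>V \<in> E\<close> \<open>V \<noteq> 0\<close> by (metis cscale_zero_left)
  next
    case False
    define U where "U = cact w V"
    define U' where "U' = cact w U + cscale (- \<i>) U"
    have "U \<in> E" using E_w \<open>V \<in> E\<close> by (simp add: U_def)
    have "U' \<in> E" unfolding U'_def by (intro E_lin E_w \<open>U \<in> E\<close>)
    have "cact w (cact w U) = - U" using cub[of "\<lambda>_. 1" V] by (simp add: U_def w_def)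
    then have "cact w U' = cscale (- \<i>) U'"
      by (simp add: U'_def cact_diff cact_cscale cscale_diff_right cscale_cscale cscale_uminus_left cscale_one)
    moreover have "cact w U = cscale \<i> U" if "U' = 0"
      using that by (simp add: U'_def cscale_uminus_left)
    ultimately show ?thesis
      using \<open>U \<in> E\<close> \<open>U' \<in> E\<close> False unfolding U_def[symmetric] by blast
  qed
  then obtain V' \<mu> where V': "V' \<in> E" "V' \<noteq> 0" "cact w V' = cscale \<mu> V'" by blast
  \<comment> \<open>The eigenvalue of Z, because Z = w minus the sum of the X_j.\<close>
  define \<nu> where "\<nu> = \<mu> - (\<Sum>j\<in>J. a j)"
  have sumV': "cact (\<Sum>j\<in>J. s j *\<^sub>R X j) V' = cscale (\<Sum>j\<in>J. of_real (s j) * a j) V'" for s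
    using V'(1) by (intro cact_sum) (simp add: E_def)
  have "cact Z V' = cact w V' - cact (\<Sum>j\<in>J. 1 *\<^sub>R X j) V'"
    unfolding cact_diff_left[symmetric] by (simp add: w_def W_def)
  also have "\<dots> = cscale \<nu> V'"
    unfolding sumV' V'(3) \<nu>_def diff_conv_add_uminus cscale_add_left cscale_uminus_left by simp
  finally have Z: "cact Z V' = cscale \<nu> V'" .
  have "\<nu> + (\<Sum>j\<in>J. of_real (s j) * a j) \<in> {0, \<i>, - \<i>}"
    if s: "\<And>j. s j = 1 \<or> s j = - 1" for s :: "nat \<Rightarrow> real"
  proof -
    define \<kappa> where "\<kappa> = \<nu> + (\<Sum>j\<in>J. of_real (s j) * a j)"
    have "cact (W s) V' = cscale \<kappa> V'"
      by (simp add: W_def cact_add_left Z sumV' \<kappa>_def cscale_add_left)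
    then have "cscale (\<kappa> * \<kappa> * \<kappa>) V' = cscale (- \<kappa>) V'"
      using cub[of s V'] s by (simp add: cact_cscale cscale_cscale cscale_uminus_left mult.assoc)
    then have "\<kappa> * \<kappa> * \<kappa> = - \<kappa>" using V'(2) by (rule cscale_inj)
    then have "\<kappa> * ((\<kappa> - \<i>) * (\<kappa> + \<i>)) = 0" by (simp add: algebra_simps)
    then have "\<kappa> \<in> {0, \<i>, - \<i>}" by (auto simp: eq_neg_iff_add_eq_0)
    then show ?thesis by (simp add: \<kappa>_def)
  qed
  from sign_sums_bound[OF finite_J this] that show ?thesis by blast
qed

text \<open>\<open>weight c x y\<close> says that \<open>[X\<^sub>j, x + iy] = i c\<^sub>j (x + iy)\<close> for all \<open>j\<close>.\<close>

definition weight :: "(nat \<Rightarrow> real) \<Rightarrow> 'a \<Rightarrow> 'a \<Rightarrow> bool" where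
  "weight c x y \<longleftrightarrow> (\<forall>j\<in>J. br (X j) x = - (c j *\<^sub>R y) \<and> br (X j) y = c j *\<^sub>R x)"

text \<open>The real form of \<open>weight\<close>: the polarized equation of \<open>m_space\<close>, which sees \<open>c\<close> only up to sign.\<close>

definition square :: "(nat \<Rightarrow> real) \<Rightarrow> 'a \<Rightarrow> bool" where
  "square c x \<longleftrightarrow> (\<forall>j\<in>J. \<forall>k\<in>J. br (X j) (br (X k) x) = - ((c j * c k) *\<^sub>R x))"

text \<open>The contrapositive of the norm bound, as the ladder arguments use it: coefficients
  outside the unit ball of the l1 norm admit no nonzero weight vector.\<close>

lemma weight_null:
  assumes w: "weight c x y" and c: "(\<Sum>j\<in>J. \<bar>c j\<bar>) > 1"
  shows "x = 0 \<and> y = 0"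
proof (rule ccontr)
  assume "\<not> (x = 0 \<and> y = 0)"
  then have "(x, y) \<noteq> 0" by (simp add: zero_prod_def)
  moreover have "cact (X j) (x, y) = cscale (\<i> * of_real (c j)) (x, y)" if "j \<in> J" for j
    using w that by (simp add: weight_def cact_def cscale_def)
  ultimately obtain c' where c': "\<And>j. j \<in> J \<Longrightarrow> \<i> * of_real (c j) = \<i> * of_real (c' j)"
    and "(\<Sum>j\<in>J. \<bar>c' j\<bar>) \<le> 1"
    using joint_eigenvalues[of "(x, y)" "\<lambda>j. \<i> * of_real (c j)"] by metis
  moreover have "(\<Sum>j\<in>J. \<bar>c' j\<bar>) = (\<Sum>j\<in>J. \<bar>c j\<bar>)" using c' by (intro sum.cong) auto
  ultimately show False using c by simp
qed

lemma weight_square: "weight c x y \<Longrightarrow> square c x" "weight c x y \<Longrightarrow> square c y"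
  unfolding weight_def square_def by (simp_all add: minus_right scaleR_right mult.commute)

text \<open>The imaginary part is forced by [X_p, x] = -c_p y, which can be solved for y as c_p is
  nonzero.\<close>

lemma square_weight:
  assumes s: "square c x" and p: "p \<in> J" "c p \<noteq> 0"
  obtains y where "weight c x y"
proof
  define u where "u = br (X p) x"
  have 1: "br (X j) u = - ((c j * c p) *\<^sub>R x)" if "j \<in> J" for j
    using s p that by (simp add: square_def u_def)
  \<comment> \<open>Both X_j X_p u and X_p X_j u are evaluated by the quadratic relations; a common
    factor c_p cancels.\<close>
  have 2: "c p *\<^sub>R br (X j) x = c j *\<^sub>R u" if j: "j \<in> J" for j
  proof -
    have "br (X j) (br (X p) u) = br (X p) (br (X j) u)"
      by (rule commute_ops[OF X_X[OF j p(1)]])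
    then have "c p *\<^sub>R (c p *\<^sub>R br (X j) x) = c p *\<^sub>R (c j *\<^sub>R u)"
      unfolding 1[OF j] 1[OF p(1)] by (simp add: minus_right scaleR_right u_def[symmetric] mult.commute)
    then show ?thesis by (rule scaleR_left_imp_eq[OF p(2)])
  qed
  have 3: "br (X j) x = (c j / c p) *\<^sub>R u" if "j \<in> J" for j
    using arg_cong[OF 2[OF that], of "\<lambda>v. inverse (c p) *\<^sub>R v"] p by (simp add: divide_inverse mult.commute)
  show "weight c x (- inverse (c p) *\<^sub>R u)"
    using p by (simp add: weight_def 1 3 minus_right scaleR_right divide_inverse mult.commute)
qed

lemma square_cong:
  "(\<And>j k. j \<in> J \<Longrightarrow> k \<in> J \<Longrightarrow> c j * c k = c' j * c' k) \<Longrightarrow> square c x = square c' x"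
  by (simp add: square_def)

lemma square_add: "square c x \<Longrightarrow> square c y \<Longrightarrow> square c (x + y)"
  by (simp add: square_def add_right algebra_simps)

lemma square_scaleR: "square c x \<Longrightarrow> square c (t *\<^sub>R x)"
  by (simp add: square_def scaleR_right mult.commute)

lemma square_Z: "square c x \<Longrightarrow> square c (br Z x)"
  by (simp add: square_def commute_ops[OF X_Z] minus_right scaleR_right)

section \<open>The action of the complex structure on weight vectors\<close>

text \<open>The operator E = Y_p + i s T_p satisfies [X_p, E] = -i s E and commutes with the other
  X_j. The two components are the real and imaginary parts of [E, x + iy].\<close>

lemma ladder:
  assumes w: "weight c x y" and p: "p \<in> J" and s: "s = 1 \<or> s = - 1"
  shows "weight (c(p := c p - s)) (br (Y p) x - s *\<^sub>R br (T p) y) (br (Y p) y + s *\<^sub>R br (T p) x)"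
  unfolding weight_def
proof (intro ballI)
  fix j assume j: "j \<in> J"
  have x: "br (X j) x = - (c j *\<^sub>R y)" and y: "br (X j) y = c j *\<^sub>R x"
    using w j by (auto simp: weight_def)
  show "br (X j) (br (Y p) x - s *\<^sub>R br (T p) y) = - ((c(p := c p - s)) j *\<^sub>R (br (Y p) y + s *\<^sub>R br (T p) x))
    \<and> br (X j) (br (Y p) y + s *\<^sub>R br (T p) x) = (c(p := c p - s)) j *\<^sub>R (br (Y p) x - s *\<^sub>R br (T p) y)"
  proof (cases "j = p")
    case True
    have x: "br (X p) x = - (c p *\<^sub>R y)" and y: "br (X p) y = c p *\<^sub>R x"
      using x y True by auto
    show ?thesis
      using s p X_Y[of p p] X_T[of p p] unfolding True
      by (auto simp: deriv[of "X p" "Y p"] deriv[of "X p" "T p"] x y add_right diff_right scaleR_right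
          minus_right minus_left algebra_simps)
  next
    case False
    then have XY0: "br (X j) (Y p) = 0" and XT0: "br (X j) (T p) = 0"
      using j p by (auto simp: X_Y X_T)
    show ?thesis
      using False by (simp add: commute_ops[OF XY0] commute_ops[OF XT0] x y add_right diff_right
          scaleR_right minus_right algebra_simps)
  qed
qed

text \<open>T_p is a multiple of the difference of the ladder operators Y_p + i T_p and Y_p - i T_p.
  Both kill x + iy when both shifts leave the region of \<open>weight_null\<close>.\<close>

lemma T_annihilates:
  assumes w: "weight c x y" and p: "p \<in> J"
    and "(\<Sum>j\<in>J. \<bar>c j\<bar>) - \<bar>c p\<bar> + \<bar>c p + 1\<bar> > 1" "(\<Sum>j\<in>J. \<bar>c j\<bar>) - \<bar>c p\<bar> + \<bar>c p - 1\<bar> > 1"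
  shows "br (T p) x = 0"
proof -
  have "br (Y p) y + br (T p) x = 0"
    using weight_null[OF ladder[OF w p, of 1]] assms unfolding sum_abs_update[OF finite_J p] by simp
  moreover have "br (Y p) y - br (T p) x = 0"
    using weight_null[OF ladder[OF w p, of "- 1"]] assms unfolding sum_abs_update[OF finite_J p] by simp
  ultimately have "2 *\<^sub>R br (T p) x = 0" unfolding scaleR_2 by (simp add: algebra_simps)
  then show ?thesis by simp
qed

text \<open>Leaving the region under the shift by s gives [Y_p, y] = s [T_p, x], so the imaginary
  part produced by the opposite shift is 2 s [T_p, x].\<close>

lemma T_shifts:
  assumes w: "weight c x y" and p: "p \<in> J" and s: "s = 1 \<or> s = - 1"
    and big: "(\<Sum>j\<in>J. \<bar>c j\<bar>) - \<bar>c p\<bar> + \<bar>c p + s\<bar> > 1"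
  shows "square (c(p := c p - s)) (br (T p) x)"
proof -
  have "weight (c(p := c p + s)) (br (Y p) x + s *\<^sub>R br (T p) y) (br (Y p) y - s *\<^sub>R br (T p) x)"
    using ladder[OF w p, of "- s"] s by auto
  moreover have "(\<Sum>j\<in>J. \<bar>(c(p := c p + s)) j\<bar>) > 1"
    using big unfolding sum_abs_update[OF finite_J p] .
  ultimately have "br (Y p) y = s *\<^sub>R br (T p) x"
    using weight_null by fastforce
  then have "square (c(p := c p - s)) ((2 * s) *\<^sub>R br (T p) x)"
    using weight_square(2)[OF ladder[OF w p s]] by (simp add: scaleR_2 flip: scaleR_scaleR)
  from square_scaleR[OF this, of "inverse (2 * s)"] show ?thesis using s by auto
qed

text \<open>For signs s_j matching c, the sum of the s_j X_j squares to -(sum |c_j|)^2 = -1 on x,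
  and adding it to Z or subtracting it gives a cubic element, as
  \<open>commuting_cubic_vanish\<close> demands.\<close>

lemma Z_annihilates:
  assumes sq: "square c x" and c: "(\<Sum>j\<in>J. \<bar>c j\<bar>) = 1"
  shows "br Z x = 0"
proof -
  define s where "s j = (if c j < 0 then - 1 else 1 :: real)" for j
  let ?x = "\<Sum>j\<in>J. s j *\<^sub>R X j"
  have "cubic br (Z + ?x)" using cubic_W[of s] by (simp add: W_def s_def)
  moreover have "cubic br (Z - ?x)"
    using cubic_W[of "\<lambda>j. - s j"] by (simp add: W_def s_def sum_negf)
  moreover have "br Z ?x = 0"
    using X_Z anti[of Z] by (simp add: sum_right scaleR_right)
  moreover have "br ?x (br ?x x) = - x"
  proof -
    have "br ?x (br ?x x) = (\<Sum>j\<in>J. \<Sum>k\<in>J. (s j * s k) *\<^sub>R br (X j) (br (X k) x))"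
      by (simp add: sum_left sum_right scaleR_left scaleR_right scaleR_sum_right)
        (subst sum.swap, simp add: mult.commute)
    also have "\<dots> = (\<Sum>j\<in>J. \<Sum>k\<in>J. - ((\<bar>c j\<bar> * \<bar>c k\<bar>) *\<^sub>R x))"
      using sq by (intro sum.cong refl) (auto simp: square_def s_def)
    also have "\<dots> = - (((\<Sum>j\<in>J. \<bar>c j\<bar>) * (\<Sum>k\<in>J. \<bar>c k\<bar>)) *\<^sub>R x)"
      by (simp add: sum_product sum_negf scaleR_sum_left)
    finally show ?thesis by (simp add: c)
  qed
  ultimately show ?thesis using commuting_cubic_vanish by blast
qed

lemma Z0_decomp: "br Z0 x = br Z x + (\<Sum>j\<in>J. br (T j) x)"
  by (simp add: Z_def diff_left sum_left)

text \<open>Each T_k with k other than p could only lead to l1 norm 3/2 and vanishes. T_p moves 1/2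
  to -1/2, a sign that \<open>square\<close> does not see, and Z preserves the weight.\<close>

lemma Z0_half:
  assumes p: "p \<in> J" and sq: "square ((\<lambda>_. 0)(p := 1/2)) x"
  shows "square ((\<lambda>_. 0)(p := 1/2)) (br Z0 x)"
proof -
  let ?c = "(\<lambda>_. 0)(p := 1/2) :: nat \<Rightarrow> real"
  obtain y where w: "weight ?c x y" using square_weight[OF sq p] by auto
  have S: "(\<Sum>j\<in>J. \<bar>?c j\<bar>) = 1/2" using sum_abs_update[OF finite_J p, of "\<lambda>_. 0" "1/2"] by simp
  have "br (T k) x = 0" if "k \<in> J" "k \<noteq> p" for k
    using T_annihilates[OF w that(1)] that S by simp
  then have "(\<Sum>j\<in>J. br (T j) x) = br (T p) x"
    using p finite_J by (subst sum.remove[of _ p]) auto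
  moreover have "square (?c(p := ?c p - 1)) (br (T p) x)"
    using T_shifts[OF w p, of 1] S by simp
  then have "square ?c (br (T p) x)" by (subst (asm) square_cong[where c' = ?c]) auto
  ultimately show ?thesis unfolding Z0_decomp by (simp add: square_add square_Z[OF sq])
qed

text \<open>The norm is already 1, so Z and all T_k with k other than p vanish on x; T_p lowers the
  coefficient 1 to 0.\<close>

lemma Z0_one:
  assumes p: "p \<in> J" and sq: "square ((\<lambda>_. 0)(p := 1)) x"
  shows "square (\<lambda>_. 0) (br Z0 x)"
proof -
  let ?c = "(\<lambda>_. 0)(p := 1) :: nat \<Rightarrow> real"
  obtain y where w: "weight ?c x y" using square_weight[OF sq p] by auto
  have S: "(\<Sum>j\<in>J. \<bar>?c j\<bar>) = 1" using sum_abs_update[OF finite_J p, of "\<lambda>_. 0" "1"] by simp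
  have "br (T k) x = 0" if "k \<in> J" "k \<noteq> p" for k
    using T_annihilates[OF w that(1)] that S by simp
  then have "(\<Sum>j\<in>J. br (T j) x) = br (T p) x"
    using p finite_J by (subst sum.remove[of _ p]) auto
  moreover have "square (?c(p := ?c p - 1)) (br (T p) x)"
    using T_shifts[OF w p, of 1] S by simp
  then have "square (\<lambda>_. 0) (br (T p) x)" by (subst (asm) square_cong[where c' = "\<lambda>_. 0"]) auto
  ultimately show ?thesis unfolding Z0_decomp by (simp add: Z_annihilates[OF sq S])
qed

text \<open>Only T_p and T_k survive. They lead to the coefficients (-1/2, s/2) and (1/2, -s/2),
  which are negatives of each other and hence give the same \<open>square\<close> condition.\<close>

lemma Z0_two:
  assumes p: "p \<in> J" and k: "k \<in> J" and pk: "p \<noteq> k" and s: "s = 1 \<or> s = - 1"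
    and sq: "square ((\<lambda>_. 0)(p := 1/2, k := s/2)) x"
  shows "square ((\<lambda>_. 0)(p := 1/2, k := - s/2)) (br Z0 x)"
proof -
  let ?c = "(\<lambda>_. 0)(p := 1/2, k := s/2) :: nat \<Rightarrow> real"
  let ?d = "(\<lambda>_. 0)(p := 1/2, k := - s/2) :: nat \<Rightarrow> real"
  obtain y where w: "weight ?c x y" using square_weight[OF sq p] pk by auto
  have S: "(\<Sum>j\<in>J. \<bar>?c j\<bar>) = 1"
    using sum_abs_update[OF finite_J k, of "(\<lambda>_. 0)(p := 1/2)" "s/2"]
      sum_abs_update[OF finite_J p, of "\<lambda>_. 0" "1/2"] pk s by auto
  have "br (T l) x = 0" if "l \<in> J" "l \<noteq> p" "l \<noteq> k" for l
    using T_annihilates[OF w that(1)] that S by simp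
  then have "(\<Sum>j\<in>J. br (T j) x) = br (T p) x + br (T k) x"
    using p k pk finite_J by (subst sum.remove[of _ p], simp, simp, subst sum.remove[of _ k]) auto
  moreover have "square (?c(p := ?c p - 1)) (br (T p) x)"
    using T_shifts[OF w p, of 1] S pk by simp
  then have "square ?d (br (T p) x)" using pk s by (subst (asm) square_cong[where c' = ?d]) auto
  moreover have "square (?c(k := ?c k - s)) (br (T k) x)"
    using T_shifts[OF w k s] S s by auto
  then have "square ?d (br (T k) x)" using pk s by (subst (asm) square_cong[where c' = ?d]) auto
  ultimately show ?thesis unfolding Z0_decomp by (simp add: Z_annihilates[OF sq S] square_add)
qed

end

section \<open>Restricted roots\<close>

definition lex_pos :: "nat \<Rightarrow> (nat \<Rightarrow> real) \<Rightarrow> bool" where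
  "lex_pos r c \<longleftrightarrow> (\<exists>p\<in>{1..r}. (\<forall>k\<in>{1..<p}. c k = 0) \<and> c p > 0)"

text \<open>The products fix a vector up to a global sign, and positivity of the first nonzero
  entry, whose index is common to both, fixes that sign.\<close>

lemma lex_pos_eqI:
  assumes prod: "\<And>j k. j \<in> {1..r} \<Longrightarrow> k \<in> {1..r} \<Longrightarrow> b j * b k = c j * c k"
    and b: "(\<forall>j\<in>{1..r}. b j = 0) \<or> lex_pos r b" and c: "(\<forall>j\<in>{1..r}. c j = 0) \<or> lex_pos r c"
    and k: "k \<in> {1..r}"
  shows "b k = c k"
proof -
  have z: "b j = 0 \<longleftrightarrow> c j = 0" if "j \<in> {1..r}" for j
    using prod[OF that that] by (metis mult_eq_0_iff)
  show ?thesis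
  proof (cases "\<forall>j\<in>{1..r}. b j = 0")
    case True
    then show ?thesis using z k by auto
  next
    case False
    then obtain p where p: "p \<in> {1..r}" "\<forall>k\<in>{1..<p}. b k = 0" "b p > 0"
      using b by (auto simp: lex_pos_def)
    then have "c p \<noteq> 0" using z[of p] by simp
    then obtain q where q: "q \<in> {1..r}" "\<forall>k\<in>{1..<q}. c k = 0" "c q > 0"
      using c p(1) by (auto simp: lex_pos_def)
    have "\<not> q < p" using q p z[of q] by auto
    moreover have "\<not> p < q" using q p \<open>c p \<noteq> 0\<close> by auto
    ultimately have "q = p" by simp
    then have "c p > 0" using q by simp
    have "(b p)\<^sup>2 = (c p)\<^sup>2" using prod[OF p(1) p(1)] by (simp add: power2_eq_square)
    then have "b p = c p" using p(3) \<open>c p > 0\<close> by (simp add: power2_eq_iff_nonneg)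
    then show ?thesis using prod[OF p(1) k] p(3) by simp
  qed
qed

text \<open>The leading coefficient is 1 or 1/2. The l1 bound leaves no room for another one in the
  first case, and for at most one more, of modulus 1/2, in the second.\<close>

lemma lex_pos_cases:
  fixes c :: "nat \<Rightarrow> real"
  assumes lex: "lex_pos r c"
    and val: "\<forall>j\<in>{1..r}. c j \<in> {0, 1/2, - 1/2, 1, - 1}"
    and sum: "(\<Sum>j\<in>{1..r}. \<bar>c j\<bar>) \<le> 1"
  obtains (half) p where "p \<in> {1..r}" "\<And>j. j \<in> {1..r} \<Longrightarrow> c j = ((\<lambda>_. 0)(p := 1/2)) j"
  | (one) p where "p \<in> {1..r}" "\<And>j. j \<in> {1..r} \<Longrightarrow> c j = ((\<lambda>_. 0)(p := 1)) j"
  | (two) p k s where "p \<in> {1..r}" "k \<in> {1..r}" "p < k" "s = 1 \<or> s = - 1"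
     "\<And>j. j \<in> {1..r} \<Longrightarrow> c j = ((\<lambda>_. 0)(p := 1/2, k := s/2)) j"
proof -
  obtain p where p: "p \<in> {1..r}" "\<forall>k\<in>{1..<p}. c k = 0" "c p > 0"
    using lex by (auto simp: lex_pos_def)
  have sub: "(\<Sum>j\<in>S. \<bar>c j\<bar>) \<le> 1" if "S \<subseteq> {1..r}" for S
    using sum_mono2[OF _ that, of "\<lambda>j. \<bar>c j\<bar>"] sum by force
  have pair: "\<bar>c p\<bar> + \<bar>c k\<bar> \<le> 1" if "k \<in> {1..r}" "k \<noteq> p" for k
    using sub[of "{p, k}"] that p(1) by simp
  consider "c p = 1" | "c p = 1/2" using val[rule_format, OF p(1)] p(3) by auto
  then show ?thesis
  proof cases
    case 1
    then have "c j = ((\<lambda>_. 0)(p := 1)) j" if "j \<in> {1..r}" for j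
      using pair[OF that] 1 by (cases "j = p") auto
    then show ?thesis by (rule that(2)[OF p(1)])
  next
    case 2
    show ?thesis
    proof (cases "\<exists>k\<in>{1..r} - {p}. c k \<noteq> 0")
      case False
      then have "c j = ((\<lambda>_. 0)(p := 1/2)) j" if "j \<in> {1..r}" for j
        using that 2 by auto
      then show ?thesis by (rule that(1)[OF p(1)])
    next
      case True
      then obtain k where k: "k \<in> {1..r}" "k \<noteq> p" "c k \<noteq> 0" by blast
      have "p < k" using k p(2) by (metis atLeastAtMost_iff atLeastLessThan_iff linorder_neqE_nat)
      define s where "s = 2 * c k"
      have s: "s = 1 \<or> s = - 1" using val[rule_format, OF k(1)] pair[OF k(1,2)] k 2 by (auto simp: s_def)
      \<comment> \<open>The coefficients at p and k already use up the whole l1 bound, so a third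
        index contributes 0.\<close>
      have "c j = ((\<lambda>_. 0)(p := 1/2, k := s/2)) j" if "j \<in> {1..r}" for j
        using sub[of "{p, k, j}"] that p(1) k 2 s by (cases "j = p \<or> j = k") (auto simp: s_def)
      then show ?thesis by (rule that(3)[OF p(1) k(1) \<open>p < k\<close> s])
    qed
  qed
qed

section \<open>The Hermitian symmetric data and the linear forms on the Cartan subspace\<close>

locale hermitian_adapted =
  fixes br :: "'a::euclidean_space \<Rightarrow> 'a \<Rightarrow> 'a"
    and K M A :: "'a set" and Z0 :: 'a
    and r :: nat and X :: "nat \<Rightarrow> 'a" and \<epsilon> :: "nat \<Rightarrow> 'a cform"
  assumes herm: "hermitian_symmetric_compact br K M Z0"
    and cartan: "cartan_subspace br M A"
    and r: "r = dim A"
    and basis: "adapted_basis br Z0 A X"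
    and dual: "dual_basis A X \<epsilon>"
begin

lemma K_M: "subspace K" "subspace M" "K \<inter> M = {0}"
  "x \<in> K \<Longrightarrow> y \<in> M \<Longrightarrow> br x y \<in> M" "x' \<in> M \<Longrightarrow> y \<in> M \<Longrightarrow> br x' y \<in> K"
  "Z0 \<in> K" "x \<in> K \<Longrightarrow> br Z0 x = 0" "y \<in> M \<Longrightarrow> br Z0 (br Z0 y) = - y"
  using herm unfolding hermitian_symmetric_compact_def lie_subalgebra_def center_of_def by blast+

lemma K_plus_M: obtains x y where "x \<in> K" "y \<in> M" "v = x + y"
proof -
  have "v \<in> {x + y |x y. x \<in> K \<and> y \<in> M}"
    using herm by (simp add: hermitian_symmetric_compact_def)
  then show ?thesis using that by blast
qed

lemma A_M: "x \<in> A \<Longrightarrow> x \<in> M" "x \<in> A \<Longrightarrow> y \<in> A \<Longrightarrow> br x y = 0"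
  using cartan by (auto simp: cartan_subspace_def abelian_def)

lemmas basis' = basis[unfolded adapted_basis_def Let_def, folded r]

lemma span_X: "inj_on X {1..r}" "span (X ` {1..r}) = A"
  by (rule basis'[THEN conjunct1], rule basis'[THEN conjunct2, THEN conjunct2, THEN conjunct1])

lemma X_A: "j \<in> {1..r} \<Longrightarrow> X j \<in> A"
  unfolding span_X(2)[symmetric] by (rule span_base) (rule imageI)

sublocale lie_alg br
  using herm by unfold_locales (simp add: hermitian_symmetric_compact_def simple_lie_algebra_def)

definition Y :: "nat \<Rightarrow> 'a" where "Y j = br Z0 (X j)"

definition T :: "nat \<Rightarrow> 'a" where "T j = br (X j) (Y j)"

sublocale adapted br Z0 X "{1..r}" Y T
proof
  have "br Z0 (br Z0 (br Z0 v)) = - br Z0 v" for v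
  proof -
    obtain x y where "x \<in> K" "y \<in> M" "v = x + y" by (rule K_plus_M)
    then show ?thesis by (simp add: add_right K_M minus_right zero_right)
  qed
  then show "cubic br Z0" by (simp add: cubic_def)
next
  show "br Z0 (Y j) = - X j" if "j \<in> {1..r}" for j
    using that by (simp add: Y_def K_M(8) A_M(1) X_A)
  show "br (X j) (X k) = 0" if "j \<in> {1..r}" "k \<in> {1..r}" for j k
    using that by (simp add: A_M(2) X_A)
next
  fix j k assume jk: "j \<in> {1..r}" "k \<in> {1..r}"
  note B = basis'[THEN conjunct2, THEN conjunct2,
      THEN conjunct2, rule_format, OF jk]
  show "br (X j) (Y k) = (if j = k then T j else 0)"
    unfolding T_def Y_def by (rule B[THEN conjunct1])
  show "br (T j) (X k) = (if j = k then Y j else 0)"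
    unfolding T_def Y_def by (rule B[THEN conjunct2, THEN conjunct1])
  show "br (T j) (Y k) = (if j = k then - X j else 0)"
    unfolding T_def Y_def by (rule B[THEN conjunct2, THEN conjunct2])
qed (simp_all add: Y_def)

text \<open>The factor i makes the values on the basis -iX_j of iA equal to the real numbers c_j,
  the coordinates that the lexicographic order compares.\<close>

definition form :: "(nat \<Rightarrow> real) \<Rightarrow> 'a cform" where
  "form c = (\<lambda>v. \<Sum>j\<in>{1..r}. \<i> * of_real (c j) * \<epsilon> j v)"

lemma A_expand:
  assumes "u \<in> A" obtains a where "u = (\<Sum>j\<in>{1..r}. a j *\<^sub>R X j)"
proof -
  have "u \<in> span (X ` {1..r})" using assms by (simp only: span_X)
  then obtain q where "u = (\<Sum>v\<in>X ` {1..r}. q v *\<^sub>R v)"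
    by (subst (asm) span_finite) auto
  then have "u = (\<Sum>j\<in>{1..r}. q (X j) *\<^sub>R X j)"
    by (simp only: sum.reindex[OF span_X(1)] o_def)
  then show ?thesis by (rule that)
qed

lemma sum_X_A: "(\<Sum>j\<in>{1..r}. a j *\<^sub>R X j) \<in> A"
proof -
  have "subspace A" using cartan by (simp add: cartan_subspace_def)
  then show ?thesis by (intro subspace_sum subspace_scale X_A)
qed

lemma cdual_sum:
  assumes \<alpha>: "\<alpha> \<in> cdual A"
  shows "\<alpha> (\<Sum>j\<in>{1..r}. a j *\<^sub>R X j, \<Sum>j\<in>{1..r}. b j *\<^sub>R X j)
     = (\<Sum>j\<in>{1..r}. Complex (a j) (b j) * \<alpha> (cembed (X j)))"
proof -
  have A: "subspace A" using cartan by (simp add: cartan_subspace_def)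
  have add: "\<alpha> (u + v) = \<alpha> u + \<alpha> v" if "u \<in> A \<times> A" "v \<in> A \<times> A" for u v
    using \<alpha> that unfolding cdual_def by blast
  have sc: "\<alpha> (cscale t v) = t * \<alpha> v" if "v \<in> A \<times> A" for t v
    using \<alpha> that unfolding cdual_def by blast
  have X: "cembed (X j) \<in> A \<times> A" if "j \<in> {1..r}" for j
    using X_A[OF that] subspace_0[OF A] by (simp add: cembed_def)
  have "\<alpha> (\<Sum>j\<in>S. a j *\<^sub>R X j, \<Sum>j\<in>S. b j *\<^sub>R X j) = (\<Sum>j\<in>S. Complex (a j) (b j) * \<alpha> (cembed (X j)))"
    if "finite S" "S \<subseteq> {1..r}" for S
    using that
  proof (induction S rule: finite_induct)
    case empty
    have "\<alpha> (cscale 0 (0, 0)) = 0 * \<alpha> (0, 0)" using subspace_0[OF A] by (intro sc) simp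
    then show ?case by (simp add: cscale_def)
  next
    case (insert p S)
    have "(\<Sum>j\<in>insert p S. a j *\<^sub>R X j, \<Sum>j\<in>insert p S. b j *\<^sub>R X j)
      = cscale (Complex (a p) (b p)) (cembed (X p)) + (\<Sum>j\<in>S. a j *\<^sub>R X j, \<Sum>j\<in>S. b j *\<^sub>R X j)"
      using insert.hyps by (simp add: cscale_def cembed_def)
    moreover have "cscale (Complex (a p) (b p)) (cembed (X p)) \<in> A \<times> A"
      using insert.prems X_A[of p] by (simp add: cscale_def cembed_def subspace_scale[OF A])
    moreover have "(\<Sum>j\<in>S. a j *\<^sub>R X j, \<Sum>j\<in>S. b j *\<^sub>R X j) \<in> A \<times> A"
      using insert.prems by (auto intro!: subspace_sum[OF A] subspace_scale[OF A] X_A)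
    ultimately show ?case
      using insert X[of p] by (simp add: add sc)
  qed
  then show ?thesis by blast
qed

lemma dual_\<epsilon>: "j \<in> {1..r} \<Longrightarrow> \<epsilon> j \<in> cdual A"
  "j \<in> {1..r} \<Longrightarrow> k \<in> {1..r} \<Longrightarrow> \<epsilon> j (cembed (X k)) = (if j = k then 1 else 0)"
  using dual by (simp_all add: dual_basis_def r[symmetric])

lemma form_cdual: "form c \<in> cdual A"
  using dual_\<epsilon>(1) unfolding cdual_def form_def
  by (auto simp: sum.distrib distrib_left sum_distrib_left mult.left_commute intro!: sum.neutral)

lemma form_X: "k \<in> {1..r} \<Longrightarrow> form c (cembed (X k)) = \<i> * of_real (c k)"
  by (simp add: form_def dual_\<epsilon>(2) if_distrib cong: if_cong)

lemma cdual_eqI: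
  assumes "\<alpha> \<in> cdual A" "\<beta> \<in> cdual A" "\<And>j. j \<in> {1..r} \<Longrightarrow> \<alpha> (cembed (X j)) = \<beta> (cembed (X j))"
  shows "\<alpha> = \<beta>"
proof
  fix v
  show "\<alpha> v = \<beta> v"
  proof (cases "v \<in> A \<times> A")
    case False
    then have "\<alpha> v = 0" "\<beta> v = 0" using assms(1,2) unfolding cdual_def by blast+
    then show ?thesis by simp
  next
    case True
    then obtain u w where v: "v = (u, w)" "u \<in> A" "w \<in> A" by blast
    obtain a where a: "u = (\<Sum>j\<in>{1..r}. a j *\<^sub>R X j)" using A_expand[OF v(2)] .
    obtain b where b: "w = (\<Sum>j\<in>{1..r}. b j *\<^sub>R X j)" using A_expand[OF v(3)] .
    show ?thesis
      unfolding v(1) a b cdual_sum[OF assms(1)] cdual_sum[OF assms(2)] using assms(3) by simp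
  qed
qed

lemma form_cong: "(\<And>j. j \<in> {1..r} \<Longrightarrow> c j = c' j) \<Longrightarrow> form c = form c'"
  by (auto simp: form_def)

lemma form_single:
  assumes "p \<in> {1..r}" shows "form ((\<lambda>_. 0)(p := a)) = (\<lambda>v. \<i> * of_real a * \<epsilon> p v)"
  unfolding form_def using assms by (intro ext, subst sum.remove[of _ p]) auto

lemma form_double:
  assumes "p \<in> {1..r}" "k \<in> {1..r}" "p \<noteq> k"
  shows "form ((\<lambda>_. 0)(p := a, k := b)) = (\<lambda>v. \<i> * (of_real a * \<epsilon> p v + of_real b * \<epsilon> k v))"
proof -
  have "form ((\<lambda>_. 0)(p := a, k := b)) = (\<lambda>v. form ((\<lambda>_. 0)(p := a)) v + form ((\<lambda>_. 0)(k := b)) v)"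
    unfolding form_def sum.distrib[symmetric] using assms(3) by (intro ext sum.cong refl) auto
  then show ?thesis unfolding form_single[OF assms(1)] form_single[OF assms(2)] by (simp add: algebra_simps)
qed

lemma form_zero: "form (\<lambda>_. 0) = (\<lambda>_. 0)"
  by (simp add: form_def)

lemma lex_positive_form: "lex_positive A X (form c) \<longleftrightarrow> lex_pos r c"
proof -
  have A: "subspace A" using cartan by (simp add: cartan_subspace_def)
  have e: "form c (cscale (- \<i>) (cembed (X k))) = of_real (c k)" if k: "k \<in> {1..r}" for k
  proof -
    have Xk: "cembed (X k) \<in> A \<times> A"
      using X_A[OF k] subspace_0[OF A] by (simp add: cembed_def)
    have sc: "\<forall>t. \<forall>v\<in>A \<times> A. form c (cscale t v) = t * form c v"
      using form_cdual[of c] unfolding cdual_def by blast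
    show ?thesis using sc[rule_format, OF Xk, of "- \<i>"] form_X[OF k] by simp
  qed
  have "(\<forall>k\<in>{1..<j}. form c (cscale (- \<i>) (cembed (X k))) = 0) \<longleftrightarrow> (\<forall>k\<in>{1..<j}. c k = 0)"
    if "j \<in> {1..r}" for j using that e by auto
  then show ?thesis
    unfolding lex_positive_def lex_pos_def r[symmetric] using e by (intro bex_cong refl) auto
qed

section \<open>Root vectors and the spaces m_lambda\<close>

lemma weight_root_space:
  assumes w: "weight c x y"
  shows "(x, y) \<in> root_space br A (form c)"
proof -
  have "cbracket br H (x, y) = cscale (form c H) (x, y)" if "H \<in> A \<times> A" for H
  proof -
    obtain u v where H: "H = (u, v)" "u \<in> A" "v \<in> A" using \<open>H \<in> A \<times> A\<close> by blast
    obtain a where a: "u = (\<Sum>j\<in>{1..r}. a j *\<^sub>R X j)" using A_expand[OF H(2)] .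
    obtain b where b: "v = (\<Sum>j\<in>{1..r}. b j *\<^sub>R X j)" using A_expand[OF H(3)] .
    define L where "L a = (\<Sum>j\<in>{1..r}. a j * c j)" for a :: "nat \<Rightarrow> real"
    have br: "br (\<Sum>j\<in>{1..r}. t j *\<^sub>R X j) x = - (L t *\<^sub>R y)"
      "br (\<Sum>j\<in>{1..r}. t j *\<^sub>R X j) y = L t *\<^sub>R x" for t
      unfolding sum_left scaleR_left L_def scaleR_sum_left sum_negf[symmetric]
      using w unfolding weight_def by (auto intro!: sum.cong)
    have "form c H = (\<Sum>j\<in>{1..r}. Complex (a j) (b j) * (\<i> * of_real (c j)))"
      unfolding H a b cdual_sum[OF form_cdual] by (intro sum.cong refl) (simp only: form_X)
    also have "\<dots> = Complex (- L b) (L a)"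
      by (simp add: complex_eq_iff L_def sum_negf)
    finally show ?thesis
      unfolding H a b cbracket_def by (simp add: br cscale_def algebra_simps del: One_nat_def)
  qed
  then show ?thesis by (simp add: root_space_def)
qed

lemma form_positive_root:
  assumes "weight c x y" "x \<noteq> 0" "lex_pos r c"
  shows "form c \<in> positive_roots br A X"
proof -
  obtain p where "p \<in> {1..r}" "c p \<noteq> 0" using assms(3) by (auto simp: lex_pos_def)
  then have "form c \<noteq> (\<lambda>_. 0)" using form_X[of p c] by auto
  moreover have "root_space br A (form c) \<noteq> {0}"
    using weight_root_space[OF assms(1)] assms(2) by (auto simp: zero_prod_def)
  ultimately show ?thesis
    using assms(3) by (simp add: positive_roots_def restricted_roots_def form_cdual lex_positive_form)
qed

text \<open>At w = sum of the a_j X_j the form has the value i L(a), so the defining equation is an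
  identity between quadratic forms in a. Its polarization, for the commuting ad X_j, is
  \<open>square\<close>.\<close>

lemma m_space_form: "m_space br M A (form c) = {\<eta>\<in>M. square c \<eta>}"
proof -
  define L where "L a = (\<Sum>j\<in>{1..r}. a j * c j)" for a :: "nat \<Rightarrow> real"
  define w where "w a = (\<Sum>j\<in>{1..r}. a j *\<^sub>R X j)" for a :: "nat \<Rightarrow> real"
  have val: "cembed u = cscale ((form c (cembed (w a)))\<^sup>2) (cembed \<eta>) \<longleftrightarrow> u = - ((L a)\<^sup>2 *\<^sub>R \<eta>)" for a u \<eta>
  proof -
    have "form c (cembed (w a)) = form c (w a, \<Sum>j\<in>{1..r}. 0 *\<^sub>R X j)"
      by (simp add: cembed_def)
    also have "\<dots> = (\<Sum>j\<in>{1..r}. Complex (a j) 0 * (\<i> * of_real (c j)))"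
      unfolding w_def cdual_sum[OF form_cdual] by (intro sum.cong refl) (simp only: form_X)
    also have "\<dots> = Complex 0 (L a)" by (simp add: complex_eq_iff L_def)
    finally have "(form c (cembed (w a)))\<^sup>2 = - of_real ((L a)\<^sup>2)"
      by (simp add: complex_eq_iff power2_eq_square)
    then show ?thesis by (simp add: cembed_def cscale_def)
  qed
  have ms: "\<eta> \<in> m_space br M A (form c) \<longleftrightarrow> \<eta> \<in> M \<and> (\<forall>a. br (w a) (br (w a) \<eta>) = - ((L a)\<^sup>2 *\<^sub>R \<eta>))" for \<eta>
  proof -
    have "(\<forall>v\<in>A. P v) \<longleftrightarrow> (\<forall>a. P (w a))" for P
      unfolding w_def using A_expand sum_X_A by metis
    note all = this
    show ?thesis unfolding m_space_def mem_Collect_eq all val ..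
  qed
  have "(\<forall>a. br (w a) (br (w a) \<eta>) = - ((L a)\<^sup>2 *\<^sub>R \<eta>)) \<longleftrightarrow> square c \<eta>" for \<eta>
  proof
    assume sq: "square c \<eta>"
    show "\<forall>a. br (w a) (br (w a) \<eta>) = - ((L a)\<^sup>2 *\<^sub>R \<eta>)"
    proof
      fix a
      have "br (w a) (br (w a) \<eta>) = (\<Sum>j\<in>{1..r}. \<Sum>k\<in>{1..r}. (a k * a j) *\<^sub>R br (X k) (br (X j) \<eta>))"
        by (simp add: w_def sum_left sum_right scaleR_left scaleR_right scaleR_sum_right mult.commute)
      also have "\<dots> = (\<Sum>j\<in>{1..r}. \<Sum>k\<in>{1..r}. - (((a j * c j) * (a k * c k)) *\<^sub>R \<eta>))"
        using sq unfolding square_def by (intro sum.cong refl) (simp add: mult_ac)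
      also have "\<dots> = - ((L a)\<^sup>2 *\<^sub>R \<eta>)"
        by (simp add: L_def power2_eq_square sum_product sum_negf scaleR_sum_left)
      finally show "br (w a) (br (w a) \<eta>) = - ((L a)\<^sup>2 *\<^sub>R \<eta>)" .
    qed
  next
    assume *: "\<forall>a. br (w a) (br (w a) \<eta>) = - ((L a)\<^sup>2 *\<^sub>R \<eta>)"
    show "square c \<eta>"
      unfolding square_def
    proof (intro ballI)
      fix j k assume jk: "j \<in> {1..r}" "k \<in> {1..r}"
      define d where "d p = (\<lambda>i. if i = p then 1 else 0 :: real)" for p :: nat
      have d: "w (d p) = X p" "L (d p) = c p" if "p \<in> {1..r}" for p
        using that by (simp_all add: w_def L_def d_def if_distrib[of "\<lambda>t. t *\<^sub>R _"] if_distrib[of "\<lambda>t. t * _"] cong: if_cong)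
      \<comment> \<open>Polarization: the equation is compared at X_j, X_k and X_j + X_k.\<close>
      have d2: "w (\<lambda>i. d j i + d k i) = X j + X k" "L (\<lambda>i. d j i + d k i) = c j + c k"
        using d[OF jk(1)] d[OF jk(2)] by (simp_all add: w_def L_def algebra_simps sum.distrib)
      have "br (X j) (br (X j) \<eta>) = - ((c j)\<^sup>2 *\<^sub>R \<eta>)" "br (X k) (br (X k) \<eta>) = - ((c k)\<^sup>2 *\<^sub>R \<eta>)"
        using *[rule_format, of "d j"] *[rule_format, of "d k"] by (simp_all add: d[OF jk(1)] d[OF jk(2)])
      moreover have "br (X j + X k) (br (X j + X k) \<eta>) = - ((c j + c k)\<^sup>2 *\<^sub>R \<eta>)"
        using *[rule_format, of "\<lambda>i. d j i + d k i"] by (simp add: d2)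
      moreover have "br (X k) (br (X j) \<eta>) = br (X j) (br (X k) \<eta>)"
        using commute_ops[OF X_X[OF jk(2,1)]] .
      ultimately have "br (X j) (br (X k) \<eta>) + (br (X j) (br (X k) \<eta>) + (c j * (c k * 2)) *\<^sub>R \<eta>) = 0"
        by (simp add: add_left add_right power2_eq_square algebra_simps)
      then have "2 *\<^sub>R (br (X j) (br (X k) \<eta>) + (c j * c k) *\<^sub>R \<eta>) = 0"
        by (simp add: scaleR_right_distrib scaleR_2[of "br (X j) (br (X k) \<eta>)"] mult_ac add_ac)
      then show "br (X j) (br (X k) \<eta>) = - ((c j * c k) *\<^sub>R \<eta>)"
        by (simp add: eq_neg_iff_add_eq_0)
    qed
  qed
  then show ?thesis using ms by blast
qed

section \<open>Classification of the positive roots and of their partners\<close>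

lemma K_M_unique:
  assumes "a \<in> K" "a' \<in> K" "b \<in> M" "b' \<in> M" "a + b = a' + b'"
  shows "a = a' \<and> b = b'"
proof -
  have "a - a' = b' - b" using assms(5) by (simp add: algebra_simps)
  moreover have "a - a' \<in> K" "b' - b \<in> M" using assms K_M(1,2) by (auto intro: subspace_diff)
  ultimately have "a - a' \<in> K \<inter> M" by simp
  then show ?thesis using K_M(3) assms(5) by simp
qed

text \<open>
  \<open>X\<^sub>j\<close> exchanges \<open>K\<close> and \<open>M\<close>, so the parts \<open>x\<^sub>M + i y\<^sub>K\<close> and \<open>x\<^sub>K + i y\<^sub>M\<close> of a root vector \<open>x + iy\<close> are root
  vectors too; this gives a nonzero vector in \<open>m_space\<close>.
\<close>

lemma positive_root_cases:
  assumes \<alpha>: "\<alpha> \<in> positive_roots br A X"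
  obtains c \<xi> where "\<alpha> = form c" "lex_pos r c" "\<forall>j\<in>{1..r}. c j \<in> {0, 1/2, - 1/2, 1, - 1}"
    "(\<Sum>j\<in>{1..r}. \<bar>c j\<bar>) \<le> 1" "\<xi> \<in> M" "\<xi> \<noteq> 0" "square c \<xi>"
proof -
  have cd: "\<alpha> \<in> cdual A" and lex: "lex_positive A X \<alpha>" and "root_space br A \<alpha> \<noteq> {0}"
    using \<alpha> by (auto simp: positive_roots_def restricted_roots_def)
  moreover have "0 \<in> root_space br A \<alpha>"
    by (simp add: root_space_def cbracket_def cscale_def zero_right)
  ultimately obtain V where V: "V \<in> root_space br A \<alpha>" "V \<noteq> 0" by blast
  have "cembed (X j) \<in> A \<times> A" if "j \<in> {1..r}" for j
    using X_A[OF that] cartan by (simp add: cembed_def cartan_subspace_def subspace_0)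
  then have "cbracket br (cembed (X j)) V = cscale (\<alpha> (cembed (X j))) V" if "j \<in> {1..r}" for j
    using V(1) that unfolding root_space_def by blast
  then have act: "cact (X j) V = cscale (\<alpha> (cembed (X j))) V" if "j \<in> {1..r}" for j
    using that by (simp add: cbracket_def cact_def cembed_def zero_left)
  from joint_eigenvalues[OF act V(2)] obtain c
    where c: "\<And>j. j \<in> {1..r} \<Longrightarrow> \<alpha> (cembed (X j)) = \<i> * of_real (c j)"
      and val: "\<forall>j\<in>{1..r}. c j \<in> {0, 1/2, - 1/2, 1, - 1}" and sum: "(\<Sum>j\<in>{1..r}. \<bar>c j\<bar>) \<le> 1"
    by metis
  have \<alpha>c: "\<alpha> = form c" by (rule cdual_eqI[OF cd form_cdual]) (simp add: c form_X)
  have lexc: "lex_pos r c" using lex by (simp add: \<alpha>c lex_positive_form)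
  obtain p where p: "p \<in> {1..r}" "c p \<noteq> 0" using lexc by (auto simp: lex_pos_def)
  obtain x y where xy: "V = (x, y)" by fastforce
  have w: "br (X j) x = - (c j *\<^sub>R y)" "br (X j) y = c j *\<^sub>R x" if "j \<in> {1..r}" for j
    using act[OF that] c[OF that]
    by (simp_all add: xy cact_def cscale_def)
  obtain xK xM where x: "xK \<in> K" "xM \<in> M" "x = xK + xM" by (rule K_plus_M)
  obtain yK yM where y: "yK \<in> K" "yM \<in> M" "y = yK + yM" by (rule K_plus_M)
  have XM: "br (X j) v \<in> K" if "j \<in> {1..r}" "v \<in> M" for j v
    using K_M(5) A_M(1) X_A that by blast
  have XK: "br (X j) v \<in> M" if "j \<in> {1..r}" "v \<in> K" for j v
    using K_M(4)[OF that(2) A_M(1)[OF X_A[OF that(1)]]] anti[of "X j" v] subspace_neg[OF K_M(2)] by simp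
  have wx: "br (X j) xM = - (c j *\<^sub>R yK) \<and> br (X j) xK = - (c j *\<^sub>R yM)" if j: "j \<in> {1..r}" for j
    by (rule K_M_unique) (use XM XK j x y w(1)[OF j] in
       \<open>auto simp: add_right algebra_simps intro!: subspace_neg[OF K_M(1)] subspace_neg[OF K_M(2)]
          subspace_scale[OF K_M(1)] subspace_scale[OF K_M(2)]\<close>)
  have wy: "br (X j) yM = c j *\<^sub>R xK \<and> br (X j) yK = c j *\<^sub>R xM" if j: "j \<in> {1..r}" for j
    by (rule K_M_unique) (use XM XK j x y w(2)[OF j] in
       \<open>auto simp: add_right algebra_simps intro!: subspace_scale[OF K_M(1)] subspace_scale[OF K_M(2)]\<close>)
  have "square c xM" using weight_square(1)[of c xM yK] wx wy unfolding weight_def by blast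
  moreover have "square c yM" using weight_square(2)[of c xK yM] wx wy unfolding weight_def by blast
  \<comment> \<open>Since c_p is nonzero, yK and xK are multiples of [X_p, xM] and [X_p, yM], so
    both M parts vanishing would make V zero.\<close>
  moreover have "xM \<noteq> 0 \<or> yM \<noteq> 0"
  proof (rule ccontr)
    assume "\<not> (xM \<noteq> 0 \<or> yM \<noteq> 0)"
    then show False using wx[OF p(1)] wy[OF p(1)] p(2) x y V(2) xy by (simp add: zero_right zero_prod_def)
  qed
  ultimately show ?thesis using that[OF \<alpha>c lexc val sum] x(2) y(2) by blast
qed

lemma Z0_M: assumes "\<xi> \<in> M" shows "br Z0 \<xi> \<in> M" "\<xi> \<noteq> 0 \<Longrightarrow> br Z0 \<xi> \<noteq> 0"
  using K_M(4)[OF K_M(6) assms] K_M(8)[OF assms] by (auto simp: zero_right)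

text \<open>The case split supplies c' through \<open>Z0_half\<close>, \<open>Z0_one\<close> and
  \<open>Z0_two\<close>. The nonzero vector \<xi> is carried along because it later pins down the
  partner.\<close>

lemma positive_root_partner:
  assumes \<alpha>: "\<alpha> \<in> positive_roots br A X"
  obtains c c' \<xi> where "\<alpha> = form c" "(form c, form c') \<in> BC_pairs r \<epsilon>"
    "(\<forall>j\<in>{1..r}. c' j = 0) \<or> lex_pos r c'"
    "\<xi> \<in> M" "\<xi> \<noteq> 0" "square c \<xi>" "\<And>\<eta>. square c \<eta> \<Longrightarrow> square c' (br Z0 \<eta>)"
proof -
  obtain b \<xi> where b: "\<alpha> = form b" "lex_pos r b" "\<forall>j\<in>{1..r}. b j \<in> {0, 1/2, - 1/2, 1, - 1}"
    "(\<Sum>j\<in>{1..r}. \<bar>b j\<bar>) \<le> 1" and \<xi>: "\<xi> \<in> M" "\<xi> \<noteq> 0" "square b \<xi>"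
    using positive_root_cases[OF \<alpha>] by blast
  show ?thesis
  proof (cases rule: lex_pos_cases[OF b(2) b(3) b(4), case_names half one two])
    case (half p)
    let ?c = "(\<lambda>_. 0)(p := 1/2) :: nat \<Rightarrow> real"
    \<comment> \<open>Only the indices 1 to r enter either notion, so the coefficients may be reset
      to 0 elsewhere.\<close>
    have e: "form b = form ?c" "square b = square ?c"
      using half(2) by (blast intro: form_cong, intro ext square_cong) simp
    have "(form ?c, form ?c) \<in> BC_pairs r \<epsilon>"
      using half(1) unfolding BC_pairs_def by (auto simp: form_single intro!: exI[of _ p])
    moreover have "lex_pos r ?c" using half(1) by (auto simp: lex_pos_def)
    ultimately show ?thesis
      using that[of ?c ?c \<xi>] b(1) \<xi> e Z0_half[OF half(1)] by simp
  next
    case (one p)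
    let ?c = "(\<lambda>_. 0)(p := 1) :: nat \<Rightarrow> real"
    have e: "form b = form ?c" "square b = square ?c"
      using one(2) by (blast intro: form_cong, intro ext square_cong) simp
    have "(form ?c, form (\<lambda>_. 0)) \<in> BC_pairs r \<epsilon>"
      using one(1) unfolding BC_pairs_def by (auto simp: form_single form_zero intro!: exI[of _ p])
    then show ?thesis
      using that[of ?c "\<lambda>_. 0" \<xi>] b(1) \<xi> e Z0_one[OF one(1)] by simp
  next
    case (two p k s)
    let ?c = "\<lambda>s. (\<lambda>_. 0)(p := 1/2, k := s/2) :: nat \<Rightarrow> real"
    have e: "form b = form (?c s)" "square b = square (?c s)"
      using two(5) by (blast intro: form_cong, intro ext square_cong) simp
    have f: "form (?c 1) = (\<lambda>v. \<i>/2 * (\<epsilon> p v + \<epsilon> k v))" "form (?c (- 1)) = (\<lambda>v. \<i>/2 * (\<epsilon> p v - \<epsilon> k v))"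
      using two(1-3) by (simp_all add: form_double algebra_simps)
    have "(form (?c s), form (?c (- s))) \<in> BC_pairs r \<epsilon>"
    proof (cases "s = 1")
      case True
      show ?thesis using two(1-3) unfolding BC_pairs_def True f by auto
    next
      case False
      then have s: "s = - 1" using two(4) by simp
      show ?thesis using two(1-3) unfolding BC_pairs_def s minus_minus f by auto
    qed
    \<comment> \<open>Only the sign of the later coefficient changes; the leading one stays
      1/2.\<close>
    moreover have "lex_pos r (?c (- s))"
      using two(1-3) unfolding lex_pos_def by (intro bexI[of _ p]) auto
    ultimately show ?thesis
      using that[of "?c s" "?c (- s)" \<xi>] b(1) \<xi> e Z0_two[OF two(1,2) _ two(4)] two(3) by simp
  qed
qed

text \<open>The vector I\<xi> is nonzero because I squares to -1 on M. Unless c' vanishes,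
  \<open>square_weight\<close> completes it to a root vector.\<close>

lemma partner_root:
  assumes "\<xi> \<in> M" "\<xi> \<noteq> 0" "square c' (br Z0 \<xi>)" "(\<forall>j\<in>{1..r}. c' j = 0) \<or> lex_pos r c'"
  shows "form c' \<in> positive_roots br A X \<union> {\<lambda>_. 0}"
proof (cases "lex_pos r c'")
  case True
  then obtain p where "p \<in> {1..r}" "c' p \<noteq> 0" by (auto simp: lex_pos_def)
  then obtain y where "weight c' (br Z0 \<xi>) y" using square_weight[OF assms(3)] by blast
  then show ?thesis using form_positive_root True Z0_M(2)[OF assms(1,2)] by blast
next
  case False
  then show ?thesis using assms(4) form_cong[of c' "\<lambda>_. 0"] by (simp add: form_zero)
qed

text \<open>A single nonzero vector common to both spaces forces equal products of coefficients, and
  \<open>lex_pos_eqI\<close> removes the remaining sign.\<close>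

lemma partner_unique:
  assumes "\<beta> \<in> positive_roots br A X \<union> {\<lambda>_. 0}" "\<zeta> \<in> m_space br M A \<beta>" "\<zeta> \<noteq> 0"
    "square c' \<zeta>" "(\<forall>j\<in>{1..r}. c' j = 0) \<or> lex_pos r c'"
  shows "\<beta> = form c'"
proof -
  obtain b where b: "\<beta> = form b" "(\<forall>j\<in>{1..r}. b j = 0) \<or> lex_pos r b"
  proof (cases "\<beta> \<in> positive_roots br A X")
    case True
    then show ?thesis using that positive_root_cases by metis
  next
    case False
    then show ?thesis using assms(1) that[of "\<lambda>_. 0"] by (simp add: form_zero)
  qed
  have "square b \<zeta>" using assms(2) by (simp add: b(1) m_space_form)
  then have "b j * b k = c' j * c' k" if "j \<in> {1..r}" "k \<in> {1..r}" for j k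
  proof -
    have "- ((b j * b k) *\<^sub>R \<zeta>) = - ((c' j * c' k) *\<^sub>R \<zeta>)"
      using \<open>square b \<zeta>\<close> assms(4) that unfolding square_def by metis
    then show ?thesis using assms(3) by simp
  qed
  from lex_pos_eqI[OF this b(2) assms(5)] show ?thesis
    unfolding b(1) by (intro form_cong)
qed

end

lemma BC_pairs_fst: "(\<alpha>, \<beta>) \<in> BC_pairs r \<epsilon> \<Longrightarrow> \<alpha> \<in> BC_pos r \<epsilon>"
  unfolding BC_pairs_def BC_pos_def by auto

theorem proposition4p7:
  fixes br :: "'a::euclidean_space \<Rightarrow> 'a \<Rightarrow> 'a"
    and K M A :: "'a set" and Z0 :: 'a
    and r :: nat and X :: "nat \<Rightarrow> 'a" and \<epsilon> :: "nat \<Rightarrow> 'a cform"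
  assumes "hermitian_symmetric_compact br K M Z0"
    and "cartan_subspace br M A"
    and "r = dim A"
    and "adapted_basis br Z0 A X"
    and "dual_basis A X \<epsilon>"
  shows "(\<forall>\<alpha>\<in>positive_roots br A X. \<exists>\<alpha>\<^sub>I\<in>positive_roots br A X \<union> {\<lambda>_. 0}.
            \<forall>\<xi>\<in>m_space br M A \<alpha>. br Z0 \<xi> \<in> m_space br M A \<alpha>\<^sub>I) \<and>
         positive_roots br A X \<subseteq> BC_pos r \<epsilon> \<and>
         {(\<alpha>, \<alpha>\<^sub>I). \<alpha> \<in> positive_roots br A X \<and> \<alpha>\<^sub>I \<in> positive_roots br A X \<union> {\<lambda>_. 0} \<and>
            (\<forall>\<xi>\<in>m_space br M A \<alpha>. br Z0 \<xi> \<in> m_space br M A \<alpha>\<^sub>I)} \<subseteq> BC_pairs r \<epsilon>"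
proof -
  interpret hermitian_adapted br K M A Z0 r X \<epsilon>
    by unfold_locales (rule assms)+
  \<comment> \<open>The uniqueness clause serves the set of pairs, which admits every partner
    compatible with \<alpha> and not just a chosen one.\<close>
  have partner: "\<exists>\<alpha>\<^sub>I\<in>positive_roots br A X \<union> {\<lambda>_. 0}. (\<alpha>, \<alpha>\<^sub>I) \<in> BC_pairs r \<epsilon> \<and>
      (\<forall>\<xi>\<in>m_space br M A \<alpha>. br Z0 \<xi> \<in> m_space br M A \<alpha>\<^sub>I) \<and>
      (\<forall>\<beta>\<in>positive_roots br A X \<union> {\<lambda>_. 0}.
        (\<forall>\<xi>\<in>m_space br M A \<alpha>. br Z0 \<xi> \<in> m_space br M A \<beta>) \<longrightarrow> \<beta> = \<alpha>\<^sub>I)"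
    if \<alpha>: "\<alpha> \<in> positive_roots br A X" for \<alpha>
  proof -
    obtain c c' \<xi> where c: "\<alpha> = form c" "(form c, form c') \<in> BC_pairs r \<epsilon>"
      "(\<forall>j\<in>{1..r}. c' j = 0) \<or> lex_pos r c'"
      and \<xi>: "\<xi> \<in> M" "\<xi> \<noteq> 0" "square c \<xi>"
      and Z0: "\<And>\<eta>. square c \<eta> \<Longrightarrow> square c' (br Z0 \<eta>)"
      using positive_root_partner[OF \<alpha>] by metis
    \<comment> \<open>With m_lambda nonzero, the condition on \<beta> is not vacuous and can be
      tested on \<xi>.\<close>
    have "\<xi> \<in> m_space br M A \<alpha>" using \<xi> by (simp add: c m_space_form)
    then have "\<beta> = form c'"
      if "\<beta> \<in> positive_roots br A X \<union> {\<lambda>_. 0}"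
        "\<forall>\<xi>\<in>m_space br M A \<alpha>. br Z0 \<xi> \<in> m_space br M A \<beta>" for \<beta>
      using partner_unique[OF that(1) _ Z0_M(2)[OF \<xi>(1,2)] Z0[OF \<xi>(3)] c(3)] that(2) by blast
    moreover have "\<forall>\<xi>\<in>m_space br M A \<alpha>. br Z0 \<xi> \<in> m_space br M A (form c')"
      using Z0 Z0_M(1) by (simp add: c(1) m_space_form)
    ultimately show ?thesis
      using partner_root[OF \<xi>(1,2) Z0[OF \<xi>(3)] c(3)] c(1,2) by blast
  qed
  show ?thesis
  proof (intro conjI)
    show "\<forall>\<alpha>\<in>positive_roots br A X. \<exists>\<alpha>\<^sub>I\<in>positive_roots br A X \<union> {\<lambda>_. 0}.
        \<forall>\<xi>\<in>m_space br M A \<alpha>. br Z0 \<xi> \<in> m_space br M A \<alpha>\<^sub>I"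
      using partner by meson
    show "positive_roots br A X \<subseteq> BC_pos r \<epsilon>"
      using partner BC_pairs_fst by (meson subsetI)
    show "{(\<alpha>, \<alpha>\<^sub>I). \<alpha> \<in> positive_roots br A X \<and> \<alpha>\<^sub>I \<in> positive_roots br A X \<union> {\<lambda>_. 0} \<and>
            (\<forall>\<xi>\<in>m_space br M A \<alpha>. br Z0 \<xi> \<in> m_space br M A \<alpha>\<^sub>I)} \<subseteq> BC_pairs r \<epsilon>"
    proof (clarify)
      fix \<alpha> \<beta> assume *: "\<alpha> \<in> positive_roots br A X" "\<beta> \<in> positive_roots br A X \<union> {\<lambda>_. 0}"
        "\<forall>\<xi>\<in>m_space br M A \<alpha>. br Z0 \<xi> \<in> m_space br M A \<beta>"
      show "(\<alpha>, \<beta>) \<in> BC_pairs r \<epsilon>"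
        using partner[OF *(1)] *(2,3) by metis
    qed
  qed
qed

end
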